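(* For all cubical sets $C$ and vertices $v\in(\mathrm{sd}^2C)([0])$, $$(\gamma\bar\gamma)_C\big(\mathrm{Star}_{\mathrm{sd}^2C}\langle v\rangle\big)\subset\mathrm{supp}_{\mathrm{sd}^2}(\langle v\rangle,C).$$
   Context: $\mathscr Q$ is the category of preordered sets and monotone functions; $[n]=\{0<\dots<n\}$. $\square_1$ is the full subcategory of $\mathscr Q$ on $[0],[1]$; $\square$ is the smallest subcategory of $\mathscr Q$ containing $\square_1$ and closed under binary $\mathscr Q$-products (of objects and of morphisms), with tensor $\otimes$ given by these products and objects $[1]^{\otimes n}$, $n\ge0$; it is the free monoidal category on $\square_1$ with unit $[0]$. $\hat\square$ is the category of presheaves on $\square$ (cubical sets), with $\otimes$ extended cocontinuously along the Yoneda embedding $\square[-]$. For an element $\sigma$ of a presheaf, $\langle\sigma\rangle$ is the smallest subpresheaf containing it; a cubical set is \emph{atomic} if it is of the form $\langle\sigma\rangle$. For a subpresheaf $B$ of a cubical set $C$, $\mathrm{Star}_CB$ is the union of all atomic subpresheaves of $C$ intersecting $B$. $\boxplus$ is the smallest sub-monoidal category of $(\mathscr Q,\times)$ generated by all monotone functions $[0]\to[1]$, $[1]\to[0]$, $[2]\to[1]$, $[1]\to[2]$ except $i\mapsto2i:[1]\to[2]$. For an object $L$ of $\boxplus$, $\square[L]$ is the cubical set $\boxplus(-,L)$ restricted to $\square^{op}$. $\mathfrak{sd}:\square\to\boxplus$ is the monoidal functor with $[0]\mapsto[0]$, $[1]\mapsto[2]$, sending $\delta:[0]\to[1]$ to the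 map $0\mapsto2\delta(0)$. $\mathrm{sd}:\hat\square\to\hat\square$ is the cocontinuous monoidal functor extending $\square[\mathfrak{sd}(-)]$ along the Yoneda embedding; it preserves monos and intersections of subobjects. $\gamma,\bar\gamma:\mathrm{sd}\to\mathrm{id}$ are the natural transformations induced by the monoidal natural transformations from $\mathfrak{sd}$ to the inclusion $\square\subset\boxplus$ with $[1]$-components $i\mapsto\max(1,i)-1$ and $i\mapsto\min(i,1):[2]\to[1]$ respectively, and $(\gamma\bar\gamma)_C=\gamma_C\circ\bar\gamma_{\mathrm{sd}C}:\mathrm{sd}^2C\to C$. For a subpresheaf $A\subset\mathrm{sd}^2C$, $\mathrm{supp}_{\mathrm{sd}^2}(A,C)$ is the intersection of all subpresheaves $B\subset C$ with $A\subset\mathrm{sd}^2B$. *)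

theory Defs
  imports "HOL-Library.FuncSet"
begin

section \<open>Products of finite chains\<close>

text \<open>
  The list \<open>[a\<^sub>1, \<dots>, a\<^sub>k]\<close> stands for the preordered set \<open>[a\<^sub>1] \<times> \<dots> \<times> [a\<^sub>k]\<close>, whose points are
  the lists \<open>[x\<^sub>1, \<dots>, x\<^sub>k]\<close> with \<open>x\<^sub>i \<le> a\<^sub>i\<close>. The empty list is \<open>[0]\<close>, the unit. Products of objects
  are concatenations, hence strictly associative and unital. Monotone functions are extensional,
  so that equality of functions is equality of morphisms.
\<close>

type_synonym point = "nat list"
type_synonym mor = "point \<Rightarrow> point"

definition points :: "nat list \<Rightarrow> point set" where
  "points L = {x. list_all2 (\<le>) x L}"

definition monotone_maps :: "nat list \<Rightarrow> nat list \<Rightarrow> mor set" where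
  "monotone_maps L M = {f \<in> points L \<rightarrow>\<^sub>E points M.
     \<forall>x\<in>points L. \<forall>y\<in>points L. list_all2 (\<le>) x y \<longrightarrow> list_all2 (\<le>) (f x) (f y)}"

definition ident :: "nat list \<Rightarrow> mor" where
  "ident L = (\<lambda>x\<in>points L. x)"

text \<open>\<open>L\<close> is the domain of \<open>f\<close>.\<close>

abbreviation comp_mor :: "nat list \<Rightarrow> mor \<Rightarrow> mor \<Rightarrow> mor" where
  "comp_mor L g f \<equiv> compose (points L) g f"

text \<open>\<open>L\<close> and \<open>L'\<close> are the domains of \<open>f\<close> and \<open>g\<close>.\<close>

definition tensor_mor :: "nat list \<Rightarrow> nat list \<Rightarrow> mor \<Rightarrow> mor \<Rightarrow> mor" where
  "tensor_mor L L' f g = (\<lambda>x\<in>points (L @ L'). f (take (length L) x) @ g (drop (length L) x))"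

section \<open>The categories \<open>\<square>\<close> and \<open>\<boxplus>\<close>, and the functor \<open>\<ss>\<dd>\<close>\<close>

abbreviation pow1 :: "nat \<Rightarrow> nat list" where "pow1 n \<equiv> replicate n 1"
abbreviation pow2 :: "nat \<Rightarrow> nat list" where "pow2 n \<equiv> replicate n 2"

text \<open>
  \<open>box_hom m n f\<close>: \<open>f\<close> is a \<open>\<square>\<close>-morphism \<open>[1]\<^sup>m \<rightarrow> [1]\<^sup>n\<close>. Identities are tensor powers of the
  identity of \<open>[1]\<close>.
\<close>

inductive box_hom :: "nat \<Rightarrow> nat \<Rightarrow> mor \<Rightarrow> bool" where
  box1: "m \<le> 1 \<Longrightarrow> n \<le> 1 \<Longrightarrow> f \<in> monotone_maps (pow1 m) (pow1 n) \<Longrightarrow> box_hom m n f"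
| comp: "box_hom l m f \<Longrightarrow> box_hom m n g \<Longrightarrow> box_hom l n (comp_mor (pow1 l) g f)"
| tensor: "box_hom m n f \<Longrightarrow> box_hom m' n' f' \<Longrightarrow>
    box_hom (m + m') (n + n') (tensor_mor (pow1 m) (pow1 m') f f')"

text \<open>\<open>boxplus_hom L M f\<close>: \<open>f\<close> is a \<open>\<boxplus>\<close>-morphism from \<open>L\<close> to \<open>M\<close>, where \<open>L\<close> and \<open>M\<close> are lists over \<open>{1, 2}\<close>.\<close>

inductive boxplus_hom :: "nat list \<Rightarrow> nat list \<Rightarrow> mor \<Rightarrow> bool" where
  gen01: "f \<in> monotone_maps [] [1] \<Longrightarrow> boxplus_hom [] [1] f"
| gen10: "f \<in> monotone_maps [1] [] \<Longrightarrow> boxplus_hom [1] [] f"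
| gen21: "f \<in> monotone_maps [2] [1] \<Longrightarrow> boxplus_hom [2] [1] f"
| gen12: "f \<in> monotone_maps [1] [2] \<Longrightarrow> f \<noteq> (\<lambda>x\<in>points [1]. map (\<lambda>i. 2 * i) x) \<Longrightarrow> boxplus_hom [1] [2] f"
| ident: "set L \<subseteq> {1, 2} \<Longrightarrow> boxplus_hom L L (ident L)"
| comp: "boxplus_hom K L f \<Longrightarrow> boxplus_hom L M g \<Longrightarrow> boxplus_hom K M (comp_mor K g f)"
| tensor: "boxplus_hom L M f \<Longrightarrow> boxplus_hom L' M' f' \<Longrightarrow>
    boxplus_hom (L @ L') (M @ M') (tensor_mor L L' f f')"

text \<open>
  The graph of the monoidal functor \<open>\<ss>\<dd>\<close> on morphisms: \<open>sd_graph m n f g\<close> says that \<open>\<ss>\<dd>\<close> sends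
  \<open>f : [1]\<^sup>m \<rightarrow> [1]\<^sup>n\<close> to \<open>g : [2]\<^sup>m \<rightarrow> [2]\<^sup>n\<close>. The value at \<open>[1] \<rightarrow> [0]\<close> is forced, \<open>[0]\<close> being terminal.
\<close>

inductive sd_graph :: "nat \<Rightarrow> nat \<Rightarrow> mor \<Rightarrow> mor \<Rightarrow> bool" where
  face: "f \<in> monotone_maps [] [1] \<Longrightarrow> sd_graph 0 1 f (\<lambda>x\<in>points []. map (\<lambda>i. 2 * i) (f x))"
| degeneracy: "f \<in> monotone_maps [1] [] \<Longrightarrow> sd_graph 1 0 f (\<lambda>x\<in>points [2]. [])"
| ident: "sd_graph n n (ident (pow1 n)) (ident (pow2 n))"
| comp: "sd_graph l m f f' \<Longrightarrow> sd_graph m n g g' \<Longrightarrow>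
    sd_graph l n (comp_mor (pow1 l) g f) (comp_mor (pow2 l) g' f')"
| tensor: "sd_graph m n f f' \<Longrightarrow> sd_graph k l g g' \<Longrightarrow>
    sd_graph (m + k) (n + l) (tensor_mor (pow1 m) (pow1 k) f g) (tensor_mor (pow2 m) (pow2 k) f' g')"

definition sd_mor :: "nat \<Rightarrow> nat \<Rightarrow> mor \<Rightarrow> mor" where
  "sd_mor m n f = (THE g. sd_graph m n f g)"

section \<open>Cubical sets\<close>

text \<open>
  \<open>cells C n\<close> is \<open>C([1]\<^sup>n)\<close>, and \<open>act C m n f\<close> is \<open>C(f) : C([1]\<^sup>n) \<rightarrow> C([1]\<^sup>m)\<close> for \<open>f : [1]\<^sup>m \<rightarrow> [1]\<^sup>n\<close>; the
  values of \<open>act\<close> elsewhere are irrelevant.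
\<close>

record 'a cset =
  cells :: "nat \<Rightarrow> 'a set"
  act :: "nat \<Rightarrow> nat \<Rightarrow> mor \<Rightarrow> 'a \<Rightarrow> 'a"

definition cubical_set :: "'a cset \<Rightarrow> bool" where
  "cubical_set C \<longleftrightarrow>
     (\<forall>m n f. \<forall>x\<in>cells C n. box_hom m n f \<longrightarrow> act C m n f x \<in> cells C m) \<and>
     (\<forall>n. \<forall>x\<in>cells C n. act C n n (ident (pow1 n)) x = x) \<and>
     (\<forall>l m n f g. \<forall>x\<in>cells C n. box_hom l m f \<longrightarrow> box_hom m n g \<longrightarrow>
        act C l n (comp_mor (pow1 l) g f) x = act C l m f (act C m n g x))"

text \<open>
  Subpresheaves of \<open>C\<close> are represented by their families of cells, ordered and intersected pointwise;
  \<open>sub_cset C B\<close> is \<open>B\<close> as a cubical set.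
\<close>

definition subpresheaf :: "(nat \<Rightarrow> 'a set) \<Rightarrow> 'a cset \<Rightarrow> bool" where
  "subpresheaf B C \<longleftrightarrow> (\<forall>n. B n \<subseteq> cells C n) \<and>
     (\<forall>m n f. \<forall>x\<in>B n. box_hom m n f \<longrightarrow> act C m n f x \<in> B m)"

definition sub_cset :: "'a cset \<Rightarrow> (nat \<Rightarrow> 'a set) \<Rightarrow> 'a cset" where
  "sub_cset C B = C\<lparr>cells := B\<rparr>"

text \<open>\<open>\<langle>\<sigma>\<rangle>\<close> for \<open>\<sigma> \<in> C([1]\<^sup>n)\<close>.\<close>

definition generated :: "'a cset \<Rightarrow> nat \<Rightarrow> 'a \<Rightarrow> nat \<Rightarrow> 'a set" where
  "generated C n \<sigma> = Inf {B. subpresheaf B C \<and> \<sigma> \<in> B n}"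

definition atomic :: "'a cset \<Rightarrow> bool" where
  "atomic C \<longleftrightarrow> (\<exists>n. \<exists>\<sigma>\<in>cells C n. cells C = generated C n \<sigma>)"

definition Star :: "'a cset \<Rightarrow> (nat \<Rightarrow> 'a set) \<Rightarrow> nat \<Rightarrow> 'a set" where
  "Star C B = Sup {A. subpresheaf A C \<and> atomic (sub_cset C A) \<and> (\<exists>n. A n \<inter> B n \<noteq> {})}"

text \<open>\<open>box_psh L\<close> is \<open>\<square>[L]\<close>, that is, \<open>\<boxplus>(-, L)\<close> restricted to \<open>\<square>\<^sup>o\<^sup>p\<close>.\<close>

definition box_psh :: "nat list \<Rightarrow> mor cset" where
  "box_psh L = \<lparr>cells = (\<lambda>k. {\<phi>. boxplus_hom (pow1 k) L \<phi>}),
                act = (\<lambda>j k f \<phi>. comp_mor (pow1 j) \<phi> f)\<rparr>"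

section \<open>Subdivision\<close>

text \<open>
  The cocontinuous extension of \<open>\<square>[\<ss>\<dd>(-)]\<close> along the Yoneda embedding is its left Kan extension, the
  coend of \<open>\<square>[\<ss>\<dd>[1]\<^sup>n] \<times> C([1]\<^sup>n)\<close>, which is formed cellwise: \<open>sd_pre C k\<close> is the disjoint
  union over \<open>n\<close> of the \<open>k\<close>-cells, and it is divided by the equivalence relation generated by
  \<open>(\<phi>, C(f)(c)) \<sim> (\<ss>\<dd>(f) \<circ> \<phi>, c)\<close>. Functions on the classes below are defined on representatives
  \<open>(n, \<phi>, c)\<close>; they are compatible with this relation, so \<open>the_elem\<close> picks the unique value.
\<close>

type_synonym 'a sd_cell = "(nat \<times> mor \<times> 'a) set"

definition sd_pre :: "'a cset \<Rightarrow> nat \<Rightarrow> (nat \<times> mor \<times> 'a) set" where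
  "sd_pre C k = {(n, \<phi>, c). \<phi> \<in> cells (box_psh (pow2 n)) k \<and> c \<in> cells C n}"

definition sd_step :: "'a cset \<Rightarrow> nat \<Rightarrow> ((nat \<times> mor \<times> 'a) \<times> (nat \<times> mor \<times> 'a)) set" where
  "sd_step C k = {((m, \<phi>, act C m n f c), (n, comp_mor (pow1 k) (sd_mor m n f) \<phi>, c)) | m n f \<phi> c.
     box_hom m n f \<and> \<phi> \<in> cells (box_psh (pow2 m)) k \<and> c \<in> cells C n}"

definition sd_class :: "'a cset \<Rightarrow> nat \<Rightarrow> nat \<times> mor \<times> 'a \<Rightarrow> 'a sd_cell" where
  "sd_class C k t = (sd_step C k \<union> (sd_step C k)\<inverse>)\<^sup>* `` {t}"

definition sd :: "'a cset \<Rightarrow> 'a sd_cell cset" where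
  "sd C = \<lparr>cells = (\<lambda>k. sd_class C k ` sd_pre C k),
           act = (\<lambda>j k f X. the_elem ((\<lambda>(n, \<phi>, c).
                    sd_class C j (n, act (box_psh (pow2 n)) j k f \<phi>, c)) ` X))\<rparr>"

text \<open>The functor \<open>sd\<close> on a natural transformation \<open>h : C \<rightarrow> D\<close>.\<close>

definition sd_map :: "'b cset \<Rightarrow> (nat \<Rightarrow> 'a \<Rightarrow> 'b) \<Rightarrow> nat \<Rightarrow> 'a sd_cell \<Rightarrow> 'b sd_cell" where
  "sd_map D h k X = the_elem ((\<lambda>(n, \<phi>, c). sd_class D k (n, \<phi>, h n c)) ` X)"

text \<open>
  \<open>sd\<^sup>2 B\<close> as a subpresheaf of \<open>sd\<^sup>2 C\<close>: the image of the (monic) transformation \<open>sd\<^sup>2 B \<rightarrow> sd\<^sup>2 C\<close>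
  induced by the inclusion of \<open>B\<close> into \<open>C\<close>.
\<close>

definition sd2_sub :: "'a cset \<Rightarrow> (nat \<Rightarrow> 'a set) \<Rightarrow> nat \<Rightarrow> 'a sd_cell sd_cell set" where
  "sd2_sub C B k = sd_map (sd C) (sd_map C (\<lambda>n x. x)) k ` cells (sd (sd (sub_cset C B))) k"

definition supp_sd2 :: "(nat \<Rightarrow> 'a sd_cell sd_cell set) \<Rightarrow> 'a cset \<Rightarrow> nat \<Rightarrow> 'a set" where
  "supp_sd2 A C = Inf {B. subpresheaf B C \<and> A \<le> sd2_sub C B}"

text \<open>
  The transformation \<open>sd \<rightarrow> id\<close> induced by a monoidal transformation from \<open>\<ss>\<dd>\<close> to the inclusion of
  \<open>\<square>\<close> into \<open>\<boxplus>\<close> with \<open>[1]\<close>-component \<open>h : [2] \<rightarrow> [1]\<close>. Its \<open>[1]\<^sup>n\<close>-component is the \<open>n\<close>-th tensor power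
  of \<open>h\<close>, which applies \<open>h\<close> to each coordinate. Its composite with \<open>\<phi> : [1]\<^sup>k \<rightarrow> [2]\<^sup>n\<close> lies in \<open>\<square>\<close> because
  \<open>\<square>\<close> is full in \<open>\<boxplus>\<close>.
\<close>

definition collapse :: "(nat \<Rightarrow> nat) \<Rightarrow> 'a cset \<Rightarrow> nat \<Rightarrow> 'a sd_cell \<Rightarrow> 'a" where
  "collapse h C k X = the_elem ((\<lambda>(n, \<phi>, c).
     act C k n (comp_mor (pow1 k) (\<lambda>x\<in>points (pow2 n). map h x) \<phi>) c) ` X)"

definition gam :: "'a cset \<Rightarrow> nat \<Rightarrow> 'a sd_cell \<Rightarrow> 'a" where
  "gam = collapse (\<lambda>i. max 1 i - 1)"

definition gam_bar :: "'a cset \<Rightarrow> nat \<Rightarrow> 'a sd_cell \<Rightarrow> 'a" where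
  "gam_bar = collapse (\<lambda>i. min i 1)"

definition gam_gam_bar :: "'a cset \<Rightarrow> nat \<Rightarrow> 'a sd_cell sd_cell \<Rightarrow> 'a" where
  "gam_gam_bar C k = gam C k \<circ> gam_bar (sd C) k"

definition image_psh :: "(nat \<Rightarrow> 'a \<Rightarrow> 'b) \<Rightarrow> (nat \<Rightarrow> 'a set) \<Rightarrow> nat \<Rightarrow> 'b set" where
  "image_psh h A k = h k ` A k"

end

theory Submission
  imports Defs
begin

text \<open>
  Write \<open>\<sigma> = [\<phi>, w]\<close> with \<open>w = [\<psi>, c]\<close> for a cell of \<open>sd\<^sup>2 C\<close> having \<open>v\<close> as the vertex \<open>a\<close>, and let \<open>B\<close> be a
  subpresheaf of \<open>C\<close> with \<open>v \<in> sd\<^sup>2 B\<close>. That a cell \<open>[\<chi>, d]\<close> of a subdivision lies in the subdivision of a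
  subpresheaf means that the restriction of \<open>d\<close> to the face of its cube supporting the image of \<open>\<chi>\<close> lies in the
  subpresheaf. Applied twice, this puts the restriction of \<open>c\<close> to a face \<open>F\<close> in \<open>B\<close>, where \<open>F\<close> supports the
  image under \<open>\<psi>\<close> of the face supporting \<open>\<phi>(a)\<close>. On the other hand \<open>\<gamma>\<close> and the barred \<open>\<gamma>\<close> send \<open>\<sigma>\<close> to the
  restriction of \<open>c\<close> along a map into the cube of \<open>c\<close>, and this map takes values in \<open>F\<close> because the
  coordinates of \<open>\<phi>\<close> and \<open>\<psi>\<close> are monotone and vary by at most \<open>1\<close> on a cube.
\<close>

section \<open>Points of products of chains, and evaluation of morphisms at them\<close>

lemma mem_points: "x \<in> points L \<longleftrightarrow> length x = length L \<and> (\<forall>i<length L. x ! i \<le> L ! i)"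
  by (auto simp: points_def list_all2_conv_all_nth)

lemma length_points: "x \<in> points L \<Longrightarrow> length x = length L"
  by (simp add: mem_points)

lemma points_Nil [simp]: "points [] = {[]}"
  by (auto simp: points_def)

lemma points_append_iff: "length a = length L \<Longrightarrow> a @ b \<in> points (L @ M) \<longleftrightarrow> a \<in> points L \<and> b \<in> points M"
  by (simp add: points_def list_all2_append)

lemma points_appendE:
  assumes "x \<in> points (L @ M)"
  obtains a b where "x = a @ b" "a \<in> points L" "b \<in> points M"
  using assms unfolding points_def by (auto simp: list_all2_append2)

lemma points_singleE:
  assumes "x \<in> points [a]"
  obtains i where "x = [i]" "i \<le> a"
  using assms by (auto simp: points_def list_all2_Cons2)

lemma points_single [simp]: "[i] \<in> points [a] \<longleftrightarrow> i \<le> a"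
  by (simp add: points_def)

lemma points_Cons [simp]: "i # x \<in> points (a # L) \<longleftrightarrow> i \<le> a \<and> x \<in> points L"
  by (simp add: points_def)

lemma mem_points_replicate: "x \<in> points (replicate n a) \<longleftrightarrow> length x = n \<and> (\<forall>i<n. x ! i \<le> a)"
  by (auto simp: mem_points)

lemma compose_apply: "x \<in> A \<Longrightarrow> compose A g f x = g (f x)"
  by (simp add: compose_def)

lemma tensor_mor_apply:
  "a \<in> points L \<Longrightarrow> b \<in> points L' \<Longrightarrow> tensor_mor L L' f g (a @ b) = f a @ g b"
  by (simp add: tensor_mor_def points_append_iff length_points)

lemma tensor_mor_extensional: "tensor_mor L L' f g \<in> extensional (points (L @ L'))"
  by (simp add: tensor_mor_def)

lemma ident_apply: "x \<in> points L \<Longrightarrow> ident L x = x"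
  by (simp add: ident_def)

section \<open>Morphisms\<close>

lemma monotone_mapsD:
  assumes "f \<in> monotone_maps L M"
  shows "x \<in> points L \<Longrightarrow> f x \<in> points M"
    and "x \<in> points L \<Longrightarrow> y \<in> points L \<Longrightarrow> list_all2 (\<le>) x y \<Longrightarrow> list_all2 (\<le>) (f x) (f y)"
    and "f \<in> extensional (points L)"
  using assms unfolding monotone_maps_def by (auto simp: PiE_def)

lemma monotone_mapsI:
  assumes "\<And>x. x \<in> points L \<Longrightarrow> f x \<in> points M"
    and "\<And>x y. x \<in> points L \<Longrightarrow> y \<in> points L \<Longrightarrow> list_all2 (\<le>) x y \<Longrightarrow> list_all2 (\<le>) (f x) (f y)"
    and "f \<in> extensional (points L)"
  shows "f \<in> monotone_maps L M"
  using assms unfolding monotone_maps_def by (auto simp: PiE_def)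

lemma monotone_maps_ident: "ident L \<in> monotone_maps L L"
  by (rule monotone_mapsI) (auto simp: ident_def)

lemma monotone_maps_comp:
  "f \<in> monotone_maps K L \<Longrightarrow> g \<in> monotone_maps L M \<Longrightarrow> comp_mor K g f \<in> monotone_maps K M"
  by (rule monotone_mapsI) (auto simp: compose_apply monotone_mapsD)

lemma monotone_maps_tensor:
  assumes "f \<in> monotone_maps L M" "g \<in> monotone_maps L' M'"
  shows "tensor_mor L L' f g \<in> monotone_maps (L @ L') (M @ M')"
proof (rule monotone_mapsI)
  fix x assume "x \<in> points (L @ L')"
  then show "tensor_mor L L' f g x \<in> points (M @ M')"
    by (auto elim!: points_appendE simp: tensor_mor_apply points_append_iff length_points
        monotone_mapsD(1)[OF assms(1)] monotone_mapsD(1)[OF assms(2)])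
next
  fix x y assume xy: "x \<in> points (L @ L')" "y \<in> points (L @ L')" "list_all2 (\<le>) x y"
  obtain a b where x: "x = a @ b" "a \<in> points L" "b \<in> points L'" using xy(1) by (rule points_appendE)
  obtain c d where y: "y = c @ d" "c \<in> points L" "d \<in> points L'" using xy(2) by (rule points_appendE)
  have "list_all2 (\<le>) a c" "list_all2 (\<le>) b d"
    using xy(3) x y by (auto simp: list_all2_append length_points)
  then show "list_all2 (\<le>) (tensor_mor L L' f g x) (tensor_mor L L' f g y)"
    using x y monotone_mapsD(2)[OF assms(1)] monotone_mapsD(2)[OF assms(2)]
    by (simp add: tensor_mor_apply list_all2_appendI)
qed (rule tensor_mor_extensional)

lemma box_hom_monotone: "box_hom m n f \<Longrightarrow> f \<in> monotone_maps (pow1 m) (pow1 n)"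
  by (induction rule: box_hom.induct) (auto simp: replicate_add intro: monotone_maps_comp monotone_maps_tensor)

lemma boxplus_hom_monotone: "boxplus_hom L M f \<Longrightarrow> f \<in> monotone_maps L M"
  by (induction rule: boxplus_hom.induct) (auto intro: monotone_maps_ident monotone_maps_comp monotone_maps_tensor)

lemma box_hom_points: "box_hom m n f \<Longrightarrow> x \<in> points (pow1 m) \<Longrightarrow> f x \<in> points (pow1 n)"
  using box_hom_monotone monotone_mapsD(1) by blast

lemma boxplus_hom_points: "boxplus_hom L M f \<Longrightarrow> x \<in> points L \<Longrightarrow> f x \<in> points M"
  using boxplus_hom_monotone monotone_mapsD(1) by blast

lemma box_hom_extensional: "box_hom m n f \<Longrightarrow> f \<in> extensional (points (pow1 m))"
  using box_hom_monotone monotone_mapsD(3) by blast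

lemma boxplus_hom_extensional: "boxplus_hom L M f \<Longrightarrow> f \<in> extensional (points L)"
  using boxplus_hom_monotone monotone_mapsD(3) by blast

lemma monotone_maps_unary:
  assumes "\<And>i. i \<le> a \<Longrightarrow> h i \<le> b" "\<And>i j. i \<le> j \<Longrightarrow> j \<le> a \<Longrightarrow> h i \<le> h j"
  shows "(\<lambda>x\<in>points [a]. [h (hd x)]) \<in> monotone_maps [a] [b]"
  using assms by (intro monotone_mapsI) (auto elim!: points_singleE)

lemma monotone_maps_unary_apply:
  assumes "f \<in> monotone_maps [a] [b]" "i \<le> a"
  shows "f [i] = [hd (f [i])]" "hd (f [i]) \<le> b"
  using monotone_mapsD(1)[OF assms(1), of "[i]"] assms(2) by (auto elim!: points_singleE)

lemma monotone_maps_unary_mono: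
  assumes "f \<in> monotone_maps [a] [b]" "i \<le> j" "j \<le> a"
  shows "hd (f [i]) \<le> hd (f [j])"
  using monotone_mapsD(2)[OF assms(1), of "[i]" "[j]"] assms(2,3)
    monotone_maps_unary_apply(1)[OF assms(1), of i] monotone_maps_unary_apply(1)[OF assms(1), of j]
  by (metis le_trans list.rel_inject(2) list.rel_intros(1) list_all2_Cons points_single)

text \<open>The middle hypothesis is what rules out i \<mapsto> 2i: for a monotone map [1]
  \<rightarrow> [2], being that map is the same as having two values that differ by more than
  1.\<close>

lemma boxplus_hom_unary_12:
  assumes "h 0 \<le> h 1" "h 1 \<le> h 0 + 1" "h 1 \<le> 2"
  shows "boxplus_hom [1] [2] (\<lambda>x\<in>points [1]. [h (hd x)])"
proof (rule boxplus_hom.gen12)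
  have "h i \<le> 2" if "i \<le> 1" for i using that assms by (cases i) auto
  moreover have "h i \<le> h j" if "i \<le> j" "j \<le> 1" for i j 
    using that assms by (cases i; cases j) auto
  ultimately show "(\<lambda>x\<in>points [1]. [h (hd x)]) \<in> monotone_maps [1] [2]"
    by (rule monotone_maps_unary)
  show "(\<lambda>x\<in>points [1]. [h (hd x)]) \<noteq> (\<lambda>x\<in>points [1]. map (\<lambda>i. 2 * i) x)" (is "?f \<noteq> ?g")
  proof
    assume eq: "?f = ?g"
    have "?f [0] = ?g [0]" "?f [1] = ?g [1]" by (simp_all only: eq)
    then show False using assms by simp
  qed
qed

text \<open>Endomaps of [1] are not among the generators of \<open>boxplus_hom\<close>, so such an
  \<open>f\<close> is factored through [2]: first i \<mapsto> i, then i \<mapsto> f(min i 1). The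
  other generating maps of the cube category have a rule of their own.\<close>

lemma box_hom_boxplus_hom: "box_hom m n f \<Longrightarrow> boxplus_hom (pow1 m) (pow1 n) f"
proof (induction rule: box_hom.induct)
  case (box1 m n f)
  consider "m = 0" "n = 0" | "m = 0" "n = 1" | "m = 1" "n = 0" | "m = 1" "n = 1"
    using box1 by linarith
  then show ?case
  proof cases
    case 1
    then have "f = ident []"
      using box1(3) monotone_mapsD[OF box1(3)] by (auto simp: ident_def fun_eq_iff extensional_def)
    then show ?thesis using 1 boxplus_hom.ident[of "[]"] by simp
  next
    case 2 then show ?thesis using box1(3) boxplus_hom.gen01[of f] by simp
  next
    case 3 then show ?thesis using box1(3) boxplus_hom.gen10[of f] by simp
  next
    case 4
    then have f: "f \<in> monotone_maps [1] [1]" using box1(3) by simp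
    have "boxplus_hom [1] [2] (\<lambda>x\<in>points [1]. [id (hd x)])"
      by (rule boxplus_hom_unary_12) auto
    moreover have "boxplus_hom [2] [1] (\<lambda>x\<in>points [2]. [hd (f [min (hd x) 1])])"
      by (rule boxplus_hom.gen21, rule monotone_maps_unary[of 2 "\<lambda>i. hd (f [min i 1])"])
        (simp_all add: monotone_maps_unary_apply(2)[OF f] monotone_maps_unary_mono[OF f] del: One_nat_def)
    ultimately have "boxplus_hom [1] [1] (comp_mor [1] (\<lambda>x\<in>points [2]. [hd (f [min (hd x) 1])]) (\<lambda>x\<in>points [1]. [id (hd x)]))"
      by (rule boxplus_hom.comp)
    also have "comp_mor [1] (\<lambda>x\<in>points [2]. [hd (f [min (hd x) 1])]) (\<lambda>x\<in>points [1]. [id (hd x)]) = f"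
      using monotone_mapsD(3)[OF f] 
      by (intro extensionalityI[of _ "points [1]"])
        (auto simp: compose_apply monotone_maps_unary_apply(1)[OF f, symmetric] min_absorb1 elim!: points_singleE)
    finally show ?thesis using 4 by simp
  qed
qed (auto simp: replicate_add intro: boxplus_hom.comp boxplus_hom.tensor)

lemma box_hom_ident: "box_hom n n (ident (pow1 n))"
proof (induction n)
  case 0 show ?case by (rule box_hom.box1) (auto simp: monotone_maps_ident)
next
  case (Suc n)
  have "box_hom 1 1 (ident (pow1 1))" by (rule box_hom.box1) (auto simp: monotone_maps_ident)
  from box_hom.tensor[OF this Suc] have "box_hom (Suc n) (Suc n) (tensor_mor (pow1 1) (pow1 n) (ident (pow1 1)) (ident (pow1 n)))"
    by simp
  also have "tensor_mor (pow1 1) (pow1 n) (ident (pow1 1)) (ident (pow1 n)) = ident (pow1 (Suc n))"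
  proof (rule extensionalityI)
    show "tensor_mor (pow1 1) (pow1 n) (ident (pow1 1)) (ident (pow1 n)) \<in> extensional (points (pow1 1 @ pow1 n))"
      by (rule tensor_mor_extensional)
    show "ident (pow1 (Suc n)) \<in> extensional (points (pow1 1 @ pow1 n))" by (simp add: ident_def)
    fix x assume x: "x \<in> points (pow1 1 @ pow1 n)"
    then show "tensor_mor (pow1 1) (pow1 n) (ident (pow1 1)) (ident (pow1 n)) x = ident (pow1 (Suc n)) x"
    proof (rule points_appendE)
      fix a b assume "x = a @ b" "a \<in> points (pow1 1)" "b \<in> points (pow1 n)"
      then show ?thesis using x by (simp only: tensor_mor_apply) (simp add: ident_def)
    qed
  qed
  finally show ?case .
qed

section \<open>Fullness\<close>

text \<open>Each coordinate has its own function, although the collapses use the same one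
  everywhere: commuting past a product of generators changes the coordinates independently, so an
  induction on morphisms needs arbitrary families.\<close>

definition coordwise :: "(nat \<Rightarrow> nat) list \<Rightarrow> nat list \<Rightarrow> mor" where
  "coordwise hs L = (\<lambda>x\<in>points L. map2 (\<lambda>h. h) hs x)"

definition to_unit :: "(nat \<Rightarrow> nat) list \<Rightarrow> nat list \<Rightarrow> bool" where
  "to_unit = list_all2 (\<lambda>h a. (\<forall>i\<le>a. h i \<le> 1) \<and> (\<forall>i j. i \<le> j \<longrightarrow> j \<le> a \<longrightarrow> h i \<le> h j))"

lemma coordwise_append:
  assumes "length hs = length L"
  shows "coordwise (hs @ hs') (L @ L') = tensor_mor L L' (coordwise hs L) (coordwise hs' L')"
  using assms by (intro extensionalityI[of _ "points (L @ L')"])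
    (auto simp: tensor_mor_extensional tensor_mor_apply coordwise_def points_append_iff length_points elim!: points_appendE)

lemma to_unit_append: "length hs = length L \<Longrightarrow> to_unit (hs @ hs') (L @ L') \<longleftrightarrow> to_unit hs L \<and> to_unit hs' L'"
  unfolding to_unit_def by (rule list_all2_append)

lemma coordwise_points:
  assumes "to_unit hs L" "x \<in> points L"
  shows "coordwise hs L x \<in> points (pow1 (length L))"
  using assms unfolding coordwise_def to_unit_def
  by (auto simp: mem_points_replicate list_all2_conv_all_nth mem_points)

lemma box_hom_coordwise: "to_unit hs (pow1 n) \<Longrightarrow> box_hom n n (coordwise hs (pow1 n))"
proof (induction n arbitrary: hs)
  case 0
  then show ?case
    by (intro box_hom.box1 monotone_mapsI) (auto simp: to_unit_def coordwise_def extensional_def)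
next
  case (Suc n)
  then obtain h hs' where hs: "hs = [h] @ hs'" "to_unit [h] (pow1 1)" "to_unit hs' (pow1 n)"
    unfolding to_unit_def by (auto simp: list_all2_Cons2)
  have "box_hom 1 1 (coordwise [h] (pow1 1))"
  proof (rule box_hom.box1)
    show "coordwise [h] (pow1 1) \<in> monotone_maps (pow1 1) (pow1 1)"
      using hs(2) by (intro monotone_mapsI) (auto simp: coordwise_def to_unit_def elim!: points_singleE)
  qed auto
  from box_hom.tensor[OF this Suc.IH[OF hs(3)]] show ?case
    unfolding hs(1) using coordwise_append[of "[h]" "pow1 1" hs' "pow1 n"] by simp
qed

text \<open>
  Commuting a coordinatewise map past generators, one at a time, moves all occurrences of \<open>[2]\<close> to the
  source, so no normal form of \<open>\<boxplus>\<close>-morphisms is needed for fullness of \<open>\<square>\<close>.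
\<close>

lemma boxplus_hom_commute_coordwise:
  assumes "boxplus_hom L M f" "to_unit hs M"
  shows "\<exists>hs' f'. to_unit hs' L \<and> box_hom (length L) (length M) f' \<and>
    (\<forall>x\<in>points L. coordwise hs M (f x) = f' (coordwise hs' L x))"
  using assms
proof (induction arbitrary: hs rule: boxplus_hom.induct)
  case (gen01 f)
  have "coordwise hs [1] \<in> monotone_maps [1] [1]"
    using box_hom_coordwise[of hs 1] gen01(2) box_hom_monotone by fastforce
  then have "box_hom 0 1 (comp_mor [] (coordwise hs [1]) f)"
    using monotone_maps_comp[OF gen01(1)] by (intro box_hom.box1) auto
  moreover have "to_unit [] []" by (simp add: to_unit_def)
  moreover have "\<forall>x\<in>points []. coordwise hs [1] (f x) = comp_mor [] (coordwise hs [1]) f (coordwise [] [] x)"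
    by (simp add: compose_def coordwise_def)
  ultimately show ?case by (metis One_nat_def length_Cons list.size(3))
next
  case (gen10 f)
  have "box_hom 1 0 f" using gen10(1) by (intro box_hom.box1) auto
  then show ?case using gen10
    by (intro exI[of _ "[\<lambda>i. i]"] exI[of _ f])
      (use monotone_mapsD(1)[OF gen10(1)] in \<open>auto simp: to_unit_def coordwise_def elim!: points_singleE\<close>)
next
  case (gen21 f)
  obtain h where hs: "hs = [h]" "\<forall>i\<le>1. h i \<le> 1" "\<forall>i j. i \<le> j \<longrightarrow> j \<le> 1 \<longrightarrow> h i \<le> h j"
    using gen21(2) by (auto simp: to_unit_def list_all2_Cons2)
  \<comment> \<open>This is the only generator with source [2]. The composite of \<open>h\<close>
    with \<open>f\<close> therefore stays a coordinate function on the source, and the cube morphism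
    left over is the identity.\<close>
  have "to_unit [\<lambda>i. h (hd (f [i]))] [2]"
    using hs monotone_maps_unary_apply[OF gen21(1)] monotone_maps_unary_mono[OF gen21(1)]
    by (auto simp: to_unit_def)
  moreover have "coordwise hs [1] (f x) = ident (pow1 1) (coordwise [\<lambda>i. h (hd (f [i]))] [2] x)"
    if x: "x \<in> points [2]" for x
  proof -
    obtain i where i: "x = [i]" "i \<le> 2" using x by (rule points_singleE)
    have "h (hd (f [i])) \<le> 1" using hs(2) monotone_maps_unary_apply[OF gen21(1) i(2)] by auto
    then show ?thesis using i monotone_mapsD(1)[OF gen21(1) x] hs(1)
      by (auto simp: coordwise_def ident_def elim!: points_singleE)
  qed
  moreover have "box_hom (length [2]) (length [1]) (ident (pow1 1))" using box_hom_ident[of 1] by simp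
  ultimately show ?case by blast
next
  case (gen12 f)
  have b: "coordwise hs [2] \<in> monotone_maps [2] [1]"
    using gen12(3) by (intro monotone_mapsI) (auto simp: coordwise_def to_unit_def list_all2_Cons2 elim!: points_singleE)
  have "box_hom 1 1 (comp_mor [1] (coordwise hs [2]) f)"
    using gen12(1) b by (intro box_hom.box1) (auto intro: monotone_maps_comp)
  moreover have "to_unit [\<lambda>i. i] [1]" by (simp add: to_unit_def)
  moreover have "\<forall>x\<in>points [1]. coordwise hs [2] (f x) = comp_mor [1] (coordwise hs [2]) f (coordwise [\<lambda>i. i] [1] x)"
    by (auto simp: compose_def coordwise_def elim!: points_singleE)
  ultimately show ?case by (metis One_nat_def length_Cons list.size(3))
next
  case (ident L)
  have "coordwise hs L (ident L x) = ident (pow1 (length L)) (coordwise hs L x)"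
    if "x \<in> points L" for x
    using that coordwise_points[OF ident(2) that] by (simp add: ident_def)
  then show ?case using ident box_hom_ident[of "length L"] by blast
next
  case (comp K L f M g)
  obtain hs1 g' where g: "to_unit hs1 L" "box_hom (length L) (length M) g'"
    "\<And>x. x \<in> points L \<Longrightarrow> coordwise hs M (g x) = g' (coordwise hs1 L x)"
    using comp.IH(2)[OF comp.prems] by blast
  obtain hs2 f' where f: "to_unit hs2 K" "box_hom (length K) (length L) f'"
    "\<And>x. x \<in> points K \<Longrightarrow> coordwise hs1 L (f x) = f' (coordwise hs2 K x)"
    using comp.IH(1)[OF g(1)] by blast
  have "coordwise hs M (comp_mor K g f x) = comp_mor (pow1 (length K)) g' f' (coordwise hs2 K x)"
    if "x \<in> points K" for x
    using that f(3) g(3) boxplus_hom_points[OF comp.hyps(1) that] coordwise_points[OF f(1) that]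
    by (simp add: compose_apply)
  then show ?case using f(1) box_hom.comp[OF f(2) g(2)] by blast
next
  case (tensor L M f L' M' g)
  define as where "as = take (length M) hs"
  define bs where "bs = drop (length M) hs"
  have len: "length hs = length M + length M'" using tensor.prems by (auto simp: to_unit_def dest: list_all2_lengthD)
  then have la: "length as = length M" and hs: "hs = as @ bs" by (auto simp: as_def bs_def)
  then have ab: "to_unit as M" "to_unit bs M'" using tensor.prems by (auto simp: to_unit_append)
  obtain as' f' where f: "to_unit as' L" "box_hom (length L) (length M) f'"
    "\<And>x. x \<in> points L \<Longrightarrow> coordwise as M (f x) = f' (coordwise as' L x)"
    using tensor.IH(1)[OF ab(1)] by blast
  obtain bs' g' where g: "to_unit bs' L'" "box_hom (length L') (length M') g'"
    "\<And>x. x \<in> points L' \<Longrightarrow> coordwise bs M' (g x) = g' (coordwise bs' L' x)"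
    using tensor.IH(2)[OF ab(2)] by blast
  have la': "length as' = length L" using f(1) by (auto simp: to_unit_def dest: list_all2_lengthD)
  have "coordwise hs (M @ M') (tensor_mor L L' f g x)
      = tensor_mor (pow1 (length L)) (pow1 (length L')) f' g' (coordwise (as' @ bs') (L @ L') x)"
    if "x \<in> points (L @ L')" for x
    using that f(3) g(3) boxplus_hom_points[OF tensor.hyps(1)] boxplus_hom_points[OF tensor.hyps(2)]
      coordwise_points[OF f(1)] coordwise_points[OF g(1)]
    by (auto elim!: points_appendE simp: hs coordwise_append la la' tensor_mor_apply)
  moreover have "to_unit (as' @ bs') (L @ L')" using f(1) g(1) la' by (simp add: to_unit_append)
  ultimately show ?case using box_hom.tensor[OF f(2) g(2)] by (metis length_append)
qed

text \<open>Fullness in the form required later. When the source is a cube, the coordinate functions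
  pulled back to it are monotone endomaps of [1], so both factors of the composite are cube
  morphisms.\<close>

lemma boxplus_hom_unit_target:
  assumes "boxplus_hom (pow1 k) M f" "to_unit hs M"
  shows "box_hom k (length M) (comp_mor (pow1 k) (coordwise hs M) f)"
proof -
  obtain hs' f' where h: "to_unit hs' (pow1 k)" "box_hom k (length M) f'"
    "\<And>x. x \<in> points (pow1 k) \<Longrightarrow> coordwise hs M (f x) = f' (coordwise hs' (pow1 k) x)"
    using boxplus_hom_commute_coordwise[OF assms] by auto
  have "comp_mor (pow1 k) (coordwise hs M) f = comp_mor (pow1 k) f' (coordwise hs' (pow1 k))"
    using h(3) by (auto simp: compose_def)
  then show ?thesis using box_hom.comp[OF box_hom_coordwise[OF h(1)] h(2)] by simp
qed


text \<open>Excluding \<open>i \<mapsto> 2i\<close> makes every \<open>\<boxplus>\<close>-morphism nonexpansive for the (one-sided) sup distance.\<close>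

lemma boxplus_hom_nonexpansive:
  assumes "boxplus_hom L M f" "x \<in> points L" "y \<in> points L" "list_all2 (\<lambda>a b. a \<le> b + 1) x y"
  shows "list_all2 (\<lambda>a b. a \<le> b + 1) (f x) (f y)"
  using assms
proof (induction arbitrary: x y rule: boxplus_hom.induct)
  case (gen01 f)
  then show ?case by (auto intro: list.rel_refl)
next
  case (gen10 f)
  then show ?case using monotone_mapsD(1)[OF gen10(1) gen10(2)] monotone_mapsD(1)[OF gen10(1) gen10(3)] by simp
next
  case (gen21 f)
  then show ?case using monotone_mapsD(1)[OF gen21(1) gen21(2)] monotone_mapsD(1)[OF gen21(1) gen21(3)]
    by (auto elim!: points_singleE)
next
  case (gen12 f)
  note u = monotone_maps_unary_apply[OF gen12(1)]
  have *: "hd (f [1]) \<le> hd (f [0]) + 1"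
  proof (rule ccontr)
    assume "\<not> ?thesis"
    then have v: "hd (f [1]) = 2" "hd (f [0]) = 0" using u(2)[of 1] by auto
    have "f = (\<lambda>x\<in>points [1]. map (\<lambda>i. 2 * i) x)"
    proof (rule extensionalityI[of _ "points [1]"])
      fix x assume "x \<in> points [1]"
      then obtain i where i: "x = [i]" "i \<le> 1" by (rule points_singleE)
      then have "i = 0 \<or> i = 1" by auto
      then show "f x = (\<lambda>x\<in>points [1]. map (\<lambda>i. 2 * i) x) x" using u(1)[of i] i v by auto
    qed (use monotone_mapsD(3)[OF gen12(1)] in auto)
    then show False using gen12(2) by simp
  qed
  obtain i j where ij: "x = [i]" "i \<le> 1" "y = [j]" "j \<le> 1" using gen12(3,4) by (auto elim!: points_singleE)
  have "hd (f [i]) \<le> hd (f [j]) + 1"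
  proof (cases "i \<le> j")
    case True
    then show ?thesis using monotone_maps_unary_mono[OF gen12(1) True ij(4)] by simp
  next
    case False
    then have "i = 1" "j = 0" using ij by auto
    then show ?thesis using * by simp
  qed
  then show ?case using u(1)[of i] u(1)[of j] ij by (metis list.rel_inject(2) list_all2_Nil)
next
  case (ident L) then show ?case by (simp add: ident_apply)
next
  case (comp K L f M g)
  then show ?case by (simp add: compose_apply boxplus_hom_points)
next
  case (tensor L M f L' M' g)
  obtain a b where x: "x = a @ b" "a \<in> points L" "b \<in> points L'" using tensor.prems(1) by (rule points_appendE)
  obtain c d where y: "y = c @ d" "c \<in> points L" "d \<in> points L'" using tensor.prems(2) by (rule points_appendE)
  have "list_all2 (\<lambda>a b. a \<le> b + 1) a c" "list_all2 (\<lambda>a b. a \<le> b + 1) b d"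
    using tensor.prems(3) x y by (auto simp: list_all2_append length_points)
  then show ?case
    using x y tensor.IH(1)[of a c] tensor.IH(2)[of b d] by (simp add: tensor_mor_apply list_all2_appendI)
qed

text \<open>Coordinates in a cube are 0 or 1, so any two of its points are within distance 1, in
  either order, and \<open>boxplus_hom_nonexpansive\<close> applies to every pair.\<close>

lemma boxplus_hom_cube_diameter:
  assumes "boxplus_hom (pow1 k) M f" "x \<in> points (pow1 k)" "y \<in> points (pow1 k)" "i < length M"
  shows "f x ! i \<le> f y ! i + 1"
proof -
  have "list_all2 (\<lambda>a b. a \<le> b + 1) x y"
    using assms(2,3) by (auto simp: list_all2_conv_all_nth mem_points_replicate intro: le_trans[OF _ le_add2])
  from boxplus_hom_nonexpansive[OF assms(1-3) this] show ?thesis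
    using assms(4) boxplus_hom_points[OF assms(1,2)] by (auto simp: list_all2_conv_all_nth mem_points)
qed

section \<open>The functor \<open>\<ss>\<dd>\<close>\<close>

text \<open>Leaving the value at 1 free treats both collapses \<gamma> and barred \<gamma> at once.
  The values at 0 and 2 are what naturality at a vertex demands, since subdivision sends the vertex
  c of [1] to the vertex 2c of [2].\<close>

definition unit_retraction :: "(nat \<Rightarrow> nat) \<Rightarrow> bool" where
  "unit_retraction h \<longleftrightarrow> h 0 = 0 \<and> h 1 \<le> 1 \<and> h 2 = 1"

lemma unit_retraction_le: "unit_retraction h \<Longrightarrow> i \<le> 2 \<Longrightarrow> h i \<le> 1"
proof -
  assume h: "unit_retraction h" "i \<le> 2"
  then have "i = 0 \<or> i = 1 \<or> i = 2" by linarith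
  with h show ?thesis by (auto simp: unit_retraction_def)
qed

lemma unit_retraction_points:
  "unit_retraction h \<Longrightarrow> x \<in> points (pow2 n) \<Longrightarrow> map h x \<in> points (pow1 n)"
  by (simp add: mem_points_replicate unit_retraction_le del: One_nat_def)

lemma unit_retraction_gam: "unit_retraction (\<lambda>i. max 1 i - 1)"
  and unit_retraction_gam_bar: "unit_retraction (\<lambda>i. min i 1)"
  by (auto simp: unit_retraction_def)

lemma sd_graph_box_hom: "sd_graph m n f g \<Longrightarrow> box_hom m n f"
proof (induction rule: sd_graph.induct)
  case (face f) then show ?case by (intro box_hom.box1) auto
next
  case (degeneracy f) then show ?case by (intro box_hom.box1) auto
qed (intro box_hom_ident box_hom.comp box_hom.tensor; assumption)+

lemma sd_graph_boxplus_hom: "sd_graph m n f g \<Longrightarrow> boxplus_hom (pow2 m) (pow2 n) g"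
proof (induction rule: sd_graph.induct)
  case (face f)
  obtain c where c: "f [] = [c]" "c \<le> 1"
    using monotone_mapsD(1)[OF face, of "[]"] by (auto elim!: points_singleE)
  \<comment> \<open>No generator runs from [0] to [2]. The point 2c is reached as c in [1] followed
    by i \<mapsto> i + c, which is an allowed map [1] \<rightarrow> [2].\<close>
  have "boxplus_hom [1] [2] (\<lambda>x\<in>points [1]. [hd x + c])"
    using c by (intro boxplus_hom_unary_12) auto
  from boxplus_hom.comp[OF boxplus_hom.gen01[OF face] this]
  have "boxplus_hom [] [2] (comp_mor [] (\<lambda>x\<in>points [1]. [hd x + c]) f)" .
  also have "comp_mor [] (\<lambda>x\<in>points [1]. [hd x + c]) f = (\<lambda>x\<in>points []. map (\<lambda>i. 2 * i) (f x))"
    using c by (auto simp: compose_def fun_eq_iff)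
  finally show ?case by simp
next
  case (degeneracy f)
  have "boxplus_hom [2] [1] (\<lambda>x\<in>points [2]. [0])"
    by (intro boxplus_hom.gen21 monotone_mapsI) auto
  from boxplus_hom.comp[OF this boxplus_hom.gen10[OF degeneracy]]
  have "boxplus_hom [2] [] (comp_mor [2] f (\<lambda>x\<in>points [2]. [0]))" .
  also have "comp_mor [2] f (\<lambda>x\<in>points [2]. [0]) = (\<lambda>x\<in>points [2]. [])"
    using monotone_mapsD(1)[OF degeneracy, of "[0]"] by (auto simp: compose_def fun_eq_iff)
  finally show ?case by simp
next
  case (ident n)
  then show ?case by (intro boxplus_hom.ident) auto
qed (auto simp: replicate_add intro: boxplus_hom.comp boxplus_hom.tensor)

text \<open>Both sides respect composition and products, so only the generators matter. This one
  identity makes the collapses well defined on classes and also determines the value of the functor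
  on \<open>f\<close>.\<close>

lemma sd_graph_natural:
  assumes "sd_graph m n f g" "unit_retraction h" "x \<in> points (pow2 m)"
  shows "map h (g x) = f (map h x)"
  using assms(1,3)
proof (induction arbitrary: x rule: sd_graph.induct)
  case (face f)
  obtain c where c: "f [] = [c]" "c \<le> 1"
    using monotone_mapsD(1)[OF face(1), of "[]"] by (auto elim!: points_singleE)
  then have "c = 0 \<or> c = 1" by auto
  then show ?case using c face assms(2) by (auto simp: unit_retraction_def)
next
  case (degeneracy f)
  then show ?case using monotone_mapsD(1)[OF degeneracy(1)] unit_retraction_points[OF assms(2), of x 1] by auto
next
  case (ident n)
  then show ?case using unit_retraction_points[OF assms(2)] by (simp add: ident_apply)
next
  case (comp l m f f' n g g')
  then show ?case
    using unit_retraction_points[OF assms(2) comp.prems] boxplus_hom_points[OF sd_graph_boxplus_hom[OF comp.hyps(1)]]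
    by (simp add: compose_apply)
next
  case (tensor m n f f' k l g g')
  obtain a b where x: "x = a @ b" "a \<in> points (pow2 m)" "b \<in> points (pow2 k)" 
    using tensor.prems by (auto simp: replicate_add elim: points_appendE)
  then show ?case using tensor.IH(1)[of a] tensor.IH(2)[of b] unit_retraction_points[OF assms(2)]
    by (simp add: tensor_mor_apply)
qed

text \<open>The pair \<open>(i \<mapsto> max 1 i - 1, i \<mapsto> min i 1)\<close> embeds \<open>[2]\<close> into \<open>[1]\<^sup>2\<close>, so naturality determines \<open>\<ss>\<dd>(f)\<close>.\<close>

lemma sd_graph_unique:
  assumes "sd_graph m n f g" "sd_graph m n f g'"
  shows "g = g'"
proof (rule extensionalityI)
  note G = sd_graph_boxplus_hom[OF assms(1)] and G' = sd_graph_boxplus_hom[OF assms(2)]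
  show "g \<in> extensional (points (pow2 m))" using G by (rule boxplus_hom_extensional)
  show "g' \<in> extensional (points (pow2 m))" using G' by (rule boxplus_hom_extensional)
  fix x assume x: "x \<in> points (pow2 m)"
  note p = boxplus_hom_points[OF G x] boxplus_hom_points[OF G' x]
  have eq: "map h (g x) = map h (g' x)" if "unit_retraction h" for h
    using sd_graph_natural[OF assms(1) that x] sd_graph_natural[OF assms(2) that x] by simp
  show "g x = g' x"
  proof (rule nth_equalityI)
    show len: "length (g x) = length (g' x)" using p by (simp add: mem_points)
    fix i assume i: "i < length (g x)"
    have "max 1 (g x ! i) - 1 = max 1 (g' x ! i) - 1" "min (g x ! i) 1 = min (g' x ! i) 1"
      using eq[OF unit_retraction_gam] eq[OF unit_retraction_gam_bar] i len
      by (metis (lifting) nth_map)+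
    then show "g x ! i = g' x ! i" by linarith
  qed
qed

text \<open>Of the maps generating the cube category, only the constant endomaps of [1] have no rule
  in \<open>sd_graph\<close>. They factor through [0], and the one remaining endomap of [1] is the
  identity.\<close>

lemma sd_graph_exists: "box_hom m n f \<Longrightarrow> \<exists>g. sd_graph m n f g"
proof (induction rule: box_hom.induct)
  case (box1 m n f)
  consider "m = 0" "n = 0" | "m = 0" "n = 1" | "m = 1" "n = 0" | "m = 1" "n = 1"
    using box1 by linarith
  then show ?case
  proof cases
    case 1
    then have "f = ident (pow1 0)"
      using box1(3) monotone_mapsD[OF box1(3)] by (auto simp: ident_def fun_eq_iff extensional_def)
    then show ?thesis using 1 sd_graph.ident[of 0] by auto
  next
    case 2 then show ?thesis using box1(3) sd_graph.face[of f] by auto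
  next
    case 3 then show ?thesis using box1(3) sd_graph.degeneracy[of f] by auto
  next
    case 4
    then have f: "f \<in> monotone_maps [1] [1]" using box1(3) by simp
    show ?thesis
    proof (cases "hd (f [0]) = hd (f [1])")
      case True
      define d :: mor where "d = (\<lambda>x\<in>points [1]. [])"
      define e :: mor where "e = (\<lambda>x\<in>points []. f [0])"
      have d: "d \<in> monotone_maps [1] []" by (intro monotone_mapsI) (auto simp: d_def)
      have e: "e \<in> monotone_maps [] [1]" using monotone_mapsD(1)[OF f, of "[0]"]
        by (intro monotone_mapsI) (auto simp: e_def extensional_def intro: list_all2_refl)
      have "f = comp_mor (pow1 1) e d"
      proof (rule extensionalityI[of _ "points [1]"])
        fix x assume "x \<in> points [1]"
        then obtain i where i: "x = [i]" "i \<le> 1" by (rule points_singleE)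
        then have "i = 0 \<or> i = 1" by auto
        then show "f x = comp_mor (pow1 1) e d x"
          using i True monotone_maps_unary_apply(1)[OF f, of 0] monotone_maps_unary_apply(1)[OF f, of 1] 
          by (auto simp: compose_def e_def d_def)
      qed (use monotone_mapsD(3)[OF f] in auto)
      then show ?thesis using sd_graph.comp[OF sd_graph.degeneracy[OF d] sd_graph.face[OF e]] 4 by auto
    next
      case False
      have v: "hd (f [0]) = 0" "hd (f [1]) = 1"
        using False monotone_maps_unary_apply(2)[OF f, of 0] monotone_maps_unary_apply(2)[OF f, of 1]
          monotone_maps_unary_mono[OF f, of 0 1] by auto
      have "f = ident (pow1 1)"
      proof (rule extensionalityI[of _ "points [1]"])
        fix x assume "x \<in> points [1]"
        then obtain i where i: "x = [i]" "i \<le> 1" by (rule points_singleE)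
        then have "i = 0 \<or> i = 1" by auto
        then show "f x = ident (pow1 1) x"
          using i v monotone_maps_unary_apply(1)[OF f, of i] by (auto simp: ident_def)
      qed (use monotone_mapsD(3)[OF f] in \<open>auto simp: ident_def\<close>)
      then show ?thesis using sd_graph.ident[of 1] 4 by auto
    qed
  qed
qed (blast intro: sd_graph.comp sd_graph.tensor)+

lemma sd_graph_sd_mor: "box_hom m n f \<Longrightarrow> sd_graph m n f (sd_mor m n f)"
  unfolding sd_mor_def using sd_graph_exists sd_graph_unique by (metis (no_types, lifting) theI)

lemma boxplus_hom_sd_mor: "box_hom m n f \<Longrightarrow> boxplus_hom (pow2 m) (pow2 n) (sd_mor m n f)"
  by (rule sd_graph_boxplus_hom[OF sd_graph_sd_mor])

section \<open>Supporting faces in a cube\<close>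

text \<open>
  The idempotent of \<open>[1]\<^sup>n\<close> onto the smallest face whose subdivision contains \<open>S \<subseteq> [2]\<^sup>n\<close>. Restriction to
  a face is thereby expressed without changing the dimension of the cube.
\<close>

definition face_proj :: "nat \<Rightarrow> point set \<Rightarrow> mor" where
  "face_proj n S = coordwise (map (\<lambda>i x. if \<forall>s\<in>S. s ! i = 0 then 0 else if \<forall>s\<in>S. s ! i = 2 then 1 else x) [0..<n]) (pow1 n)"

lemma box_hom_face_proj: "box_hom n n (face_proj n S)"
  unfolding face_proj_def by (rule box_hom_coordwise) (auto simp: to_unit_def list_all2_conv_all_nth)

lemma face_proj_points: "x \<in> points (pow1 n) \<Longrightarrow> face_proj n S x \<in> points (pow1 n)"
  by (rule box_hom_points[OF box_hom_face_proj])

lemma face_proj_nth: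
  assumes "x \<in> points (pow1 n)" "i < n"
  shows "face_proj n S x ! i = (if \<forall>s\<in>S. s ! i = 0 then 0 else if \<forall>s\<in>S. s ! i = 2 then 1 else x ! i)"
  using assms by (simp add: face_proj_def coordwise_def mem_points_replicate)

lemma face_proj_idem:
  assumes "x \<in> points (pow1 n)"
  shows "face_proj n S (face_proj n S x) = face_proj n S x"
  using face_proj_points[OF assms, of S] face_proj_points[OF face_proj_points[OF assms], of S S] assms
  by (intro nth_equalityI) (auto simp: length_points face_proj_nth)

text \<open>The condition defining \<open>face_proj\<close> looks at one coordinate at a time, so
  the supporting face in a product is the product of the supporting faces of the two projections of
  \<open>S\<close>. The tensor cases below rest on this.\<close>

lemma face_proj_append:
  assumes "S \<subseteq> points (pow2 (m + k))" "a \<in> points (pow1 m)" "b \<in> points (pow1 k)"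
  shows "face_proj (m + k) S (a @ b) = face_proj m (take m ` S) a @ face_proj k (drop m ` S) b"
proof (rule nth_equalityI)
  have ab: "a @ b \<in> points (pow1 (m + k))"
    using assms(2,3) by (simp add: replicate_add points_append_iff length_points)
  have len: "length (face_proj m (take m ` S) a) = m" "length (face_proj k (drop m ` S) b) = k"
    "length (face_proj (m + k) S (a @ b)) = m + k"
    using face_proj_points[OF assms(2)] face_proj_points[OF assms(3)] face_proj_points[OF ab]
    by (simp_all add: mem_points_replicate)
  show "length (face_proj (m + k) S (a @ b)) = length (face_proj m (take m ` S) a @ face_proj k (drop m ` S) b)"
    by (simp add: len)
  fix i assume "i < length (face_proj (m + k) S (a @ b))"
  then have i: "i < m + k" by (simp add: len)
  have S: "length s = m + k" if "s \<in> S" for s using that assms(1) by (auto simp: mem_points_replicate)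
  have la: "length a = m" using assms(2) by (simp add: mem_points_replicate)
  show "face_proj (m + k) S (a @ b) ! i = (face_proj m (take m ` S) a @ face_proj k (drop m ` S) b) ! i"
  proof (cases "i < m")
    case True
    then show ?thesis using i assms(2) face_proj_nth[OF ab i] by (simp add: nth_append len la face_proj_nth)
  next
    case False
    then have "(drop m s) ! (i - m) = s ! i" if "s \<in> S" for s using S[OF that] i by simp
    then show ?thesis using False i assms(3) face_proj_nth[OF ab i] by (simp add: nth_append len la face_proj_nth)
  qed
qed

text \<open>\<open>S\<close> need not be a product of sets. Supporting faces see only its two
  projections, and a product of maps carries each projection along by its own factor.\<close>

lemma image_tensor_mor:
  assumes "S \<subseteq> points (L @ L')" "\<And>x. x \<in> points L \<Longrightarrow> length (f x) = n"
  shows "take n ` tensor_mor L L' f g ` S = f ` take (length L) ` S"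
    and "drop n ` tensor_mor L L' f g ` S = g ` drop (length L) ` S"
proof -
  have "take n (tensor_mor L L' f g s) = f (take (length L) s) \<and> drop n (tensor_mor L L' f g s) = g (drop (length L) s)"
    if "s \<in> S" for s
  proof -
    have "s \<in> points (L @ L')" using that assms(1) by blast
    then show ?thesis by (rule points_appendE) (simp add: tensor_mor_apply assms(2) length_points)
  qed
  then show "take n ` tensor_mor L L' f g ` S = f ` take (length L) ` S"
    and "drop n ` tensor_mor L L' f g ` S = g ` drop (length L) ` S"
    by (auto simp: image_image)
qed

lemma take_drop_points:
  assumes "S \<subseteq> points (L @ L')"
  shows "take (length L) ` S \<subseteq> points L" "drop (length L) ` S \<subseteq> points L'"
  using assms by (auto elim!: points_appendE dest!: subsetD simp: length_points)

text \<open>Geometrically, the face supporting \<open>S\<close> lands in the face supporting the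
  image of \<open>S\<close>; this holds on generators and passes to composites and products. Over
  the empty set \<open>face_proj\<close> is constantly 0, which would fail for the vertex 1 of [1],
  hence the condition that \<open>S\<close> is nonempty.\<close>

lemma sd_graph_face_proj_fixed:
  assumes "sd_graph m n f g" "S \<subseteq> points (pow2 m)" "S \<noteq> {}" "x \<in> points (pow1 m)"
  shows "face_proj n (g ` S) (f (face_proj m S x)) = f (face_proj m S x)"
  using assms
proof (induction arbitrary: S x rule: sd_graph.induct)
  case (face f)
  then have S: "S = {[]}" by auto
  obtain c where c: "f [] = [c]" "c \<le> 1"
    using monotone_mapsD(1)[OF face(1), of "[]"] by (auto elim!: points_singleE)
  then have "c = 0 \<or> c = 1" by auto
  then show ?case using face c S
    by (auto simp: face_proj_def coordwise_def)
next
  case (degeneracy f)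
  have "face_proj 1 S x \<in> points (pow1 1)" using degeneracy by (intro face_proj_points) auto
  then have "f (face_proj 1 S x) = []" using monotone_mapsD(1)[OF degeneracy(1)] by auto
  then show ?case by (simp add: face_proj_def coordwise_def)
next
  case (ident n)
  have "ident (pow2 n) ` S = S" using ident(1) by (auto simp: ident_def subset_iff image_iff)
  then show ?case using face_proj_idem[OF ident(3)] face_proj_points[OF ident(3)] by (simp add: ident_apply)
next
  case (comp l m f f' n g g')
  have im: "comp_mor (pow2 l) g' f' ` S = g' ` (f' ` S)"
    using comp.prems(1) by (auto simp: compose_apply subset_iff image_iff)
  have S': "f' ` S \<subseteq> points (pow2 m)"
    using boxplus_hom_points[OF sd_graph_boxplus_hom[OF comp.hyps(1)]] comp.prems(1) by auto
  have p: "face_proj l S x \<in> points (pow1 l)" using comp.prems by (intro face_proj_points)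
  then have y: "f (face_proj l S x) \<in> points (pow1 m)"
    by (rule box_hom_points[OF sd_graph_box_hom[OF comp.hyps(1)]])
  show ?case
    using comp.IH(1)[OF comp.prems] comp.IH(2)[OF S' _ y] comp.prems(2) p by (simp add: im compose_apply)
next
  case (tensor m n f f' k l g g')
  have S: "S \<subseteq> points (pow2 m @ pow2 k)" using tensor.prems(1) by (simp add: replicate_add)
  obtain a b where x: "x = a @ b" "a \<in> points (pow1 m)" "b \<in> points (pow1 k)" 
    using tensor.prems(3) by (auto simp: replicate_add elim: points_appendE)
  let ?T = "tensor_mor (pow2 m) (pow2 k) f' g'"
  have len: "length (f' s) = n" if "s \<in> points (pow2 m)" for s
    using boxplus_hom_points[OF sd_graph_boxplus_hom[OF tensor.hyps(1)] that] by (simp add: mem_points_replicate)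
  note im = image_tensor_mor[OF S len, where g = g', simplified]
  note td = take_drop_points[OF S, simplified]
  have TS: "?T ` S \<subseteq> points (pow2 (n + l))"
    using boxplus_hom_points[OF sd_graph_boxplus_hom[OF sd_graph.tensor[OF tensor.hyps]]] tensor.prems(1) by auto
  have p: "face_proj m (take m ` S) a \<in> points (pow1 m)" "face_proj k (drop m ` S) b \<in> points (pow1 k)"
    using x(2,3) by (simp_all only: face_proj_points)
  have q: "f (face_proj m (take m ` S) a) \<in> points (pow1 n)" "g (face_proj k (drop m ` S) b) \<in> points (pow1 l)"
    using p box_hom_points[OF sd_graph_box_hom[OF tensor.hyps(1)]] box_hom_points[OF sd_graph_box_hom[OF tensor.hyps(2)]] by auto
  show ?case
    using tensor.IH(1)[OF td(1) _ x(2)] tensor.IH(2)[OF td(2) _ x(3)] tensor.prems(2) p q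
    by (simp add: x(1) face_proj_append[OF tensor.prems(1) x(2,3)] tensor_mor_apply face_proj_append[OF TS] im)
qed

text \<open>Converse to \<open>sd_graph_face_proj_fixed\<close>: \<open>f\<close> maps the one face
  onto the other, and the map is split by a cube morphism \<open>t\<close>. A splitting, rather than
  surjectivity on points, is what allows cells of a presheaf to be pulled back.\<close>

lemma sd_graph_face_proj_section:
  assumes "sd_graph m n f g" "S \<subseteq> points (pow2 m)" "S \<noteq> {}"
  shows "\<exists>t. box_hom n m t \<and> (\<forall>x\<in>points (pow1 n). f (face_proj m S (t x)) = face_proj n (g ` S) x)"
  using assms
proof (induction arbitrary: S rule: sd_graph.induct)
  case (face f)
  then have S: "S = {[]}" by auto
  obtain c where c: "f [] = [c]" "c \<le> 1"
    using monotone_mapsD(1)[OF face(1), of "[]"] by (auto elim!: points_singleE)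
  then have c01: "c = 0 \<or> c = 1" by auto
  have t: "box_hom 1 0 (\<lambda>x\<in>points [1]. [])"
    by (intro box_hom.box1 monotone_mapsI) auto
  have "f (face_proj 0 S ((\<lambda>x\<in>points [1]. []) x)) = face_proj 1 ((\<lambda>x\<in>points []. map (\<lambda>i. 2 * i) (f x)) ` S) x"
    if "x \<in> points (pow1 1)" for x
    using that c c01 S by (auto simp: face_proj_def coordwise_def elim!: points_singleE)
  then show ?case using t by blast
next
  case (degeneracy f)
  \<comment> \<open>The vertex 0 is an arbitrary choice, since \<open>f\<close> forgets the
    coordinate.\<close>
  have t: "box_hom 0 1 (\<lambda>x\<in>points []. [0])"
    by (intro box_hom.box1 monotone_mapsI) (auto simp: extensional_def)
  have "face_proj 1 S [0] \<in> points (pow1 1)" by (intro face_proj_points) auto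
  then have "f (face_proj 1 S [0]) = []" using monotone_mapsD(1)[OF degeneracy(1)] by auto
  then have "\<forall>x\<in>points (pow1 0). f (face_proj 1 S ((\<lambda>x\<in>points []. [0]) x)) = face_proj 0 ((\<lambda>x\<in>points [2]. []) ` S) x"
    by (simp add: face_proj_def[of 0] coordwise_def)
  then show ?case using t by blast
next
  case (ident n)
  have "ident (pow2 n) ` S = S" using ident(1) by (auto simp: ident_def subset_iff image_iff)
  then have "\<forall>x\<in>points (pow1 n). ident (pow1 n) (face_proj n S (ident (pow1 n) x)) = face_proj n (ident (pow2 n) ` S) x"
    using face_proj_points by (simp add: ident_apply)
  then show ?case using box_hom_ident by blast
next
  case (comp l m f f' n g g')
  have im: "comp_mor (pow2 l) g' f' ` S = g' ` (f' ` S)"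
    using comp.prems(1) by (auto simp: compose_apply subset_iff image_iff)
  have S': "f' ` S \<subseteq> points (pow2 m)"
    using boxplus_hom_points[OF sd_graph_boxplus_hom[OF comp.hyps(1)]] comp.prems(1) by auto
  obtain t where t: "box_hom m l t" "\<And>x. x \<in> points (pow1 m) \<Longrightarrow> f (face_proj l S (t x)) = face_proj m (f' ` S) x"
    using comp.IH(1)[OF comp.prems] by blast
  obtain u where u: "box_hom n m u" "\<And>x. x \<in> points (pow1 n) \<Longrightarrow> g (face_proj m (f' ` S) (u x)) = face_proj n (g' ` f' ` S) x"
    using comp.IH(2)[OF S'] comp.prems by blast
  \<comment> \<open>The two sections compose in the opposite order: \<open>t\<close> turns
    \<open>f\<close> into the projection onto the intermediate face, and that projection is what the
    equation for \<open>u\<close> expects inside \<open>g\<close>.\<close>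
  have "\<forall>x\<in>points (pow1 n). comp_mor (pow1 l) g f (face_proj l S (comp_mor (pow1 n) t u x))
      = face_proj n (comp_mor (pow2 l) g' f' ` S) x"
    using t u box_hom_points[OF u(1)] box_hom_points[OF t(1)] face_proj_points by (simp add: im compose_apply)
  then show ?case using box_hom.comp[OF u(1) t(1)] by blast
next
  case (tensor m n f f' k l g g')
  have S: "S \<subseteq> points (pow2 m @ pow2 k)" using tensor.prems(1) by (simp add: replicate_add)
  let ?T = "tensor_mor (pow2 m) (pow2 k) f' g'"
  have len: "length (f' s) = n" if "s \<in> points (pow2 m)" for s
    using boxplus_hom_points[OF sd_graph_boxplus_hom[OF tensor.hyps(1)] that] by (simp add: mem_points_replicate)
  note im = image_tensor_mor[OF S len, where g = g', simplified]
  note td = take_drop_points[OF S, simplified]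
  have TS: "?T ` S \<subseteq> points (pow2 (n + l))"
    using boxplus_hom_points[OF sd_graph_boxplus_hom[OF sd_graph.tensor[OF tensor.hyps]]] tensor.prems(1) by auto
  obtain t where t: "box_hom n m t" "\<And>x. x \<in> points (pow1 n) \<Longrightarrow> f (face_proj m (take m ` S) (t x)) = face_proj n (f' ` take m ` S) x"
    using tensor.IH(1)[OF td(1)] tensor.prems(2) by blast
  obtain u where u: "box_hom l k u" "\<And>x. x \<in> points (pow1 l) \<Longrightarrow> g (face_proj k (drop m ` S) (u x)) = face_proj l (g' ` drop m ` S) x"
    using tensor.IH(2)[OF td(2)] tensor.prems(2) by blast
  have "tensor_mor (pow1 m) (pow1 k) f g (face_proj (m + k) S (tensor_mor (pow1 n) (pow1 l) t u x))
      = face_proj (n + l) (?T ` S) x" if xp: "x \<in> points (pow1 (n + l))" for x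
  proof -
    obtain a b where x: "x = a @ b" "a \<in> points (pow1 n)" "b \<in> points (pow1 l)" 
      using xp by (auto simp: replicate_add elim: points_appendE)
    have p: "t a \<in> points (pow1 m)" "u b \<in> points (pow1 k)"
      using x box_hom_points[OF t(1)] box_hom_points[OF u(1)] by auto
    show ?thesis
      using x t(2) u(2) p face_proj_points[OF p(1)] face_proj_points[OF p(2)]
      by (simp add: tensor_mor_apply face_proj_append[OF tensor.prems(1)] face_proj_append[OF TS] im)
  qed
  then show ?case using box_hom.tensor[OF t(1) u(1)] by blast
qed

text \<open>
  Combinatorial core: \<open>a\<close> is the vertex of the star and \<open>S\<close> lies over the supporting face of \<open>\<phi> a\<close>. Since
  coordinates of \<open>\<phi>\<close> vary by at most \<open>1\<close>, a coordinate equal to \<open>2\<close> at \<open>a\<close> is sent to \<open>1\<close> by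
  \<open>i \<mapsto> min i 1\<close> throughout; hence the projection to that face lies below the identity at \<open>y\<close>, and monotonicity of
  \<open>\<psi>\<close> preserves the coordinates equal to \<open>2\<close>, while \<open>i \<mapsto> max 1 i - 1\<close> absorbs those equal to \<open>0\<close>.
\<close>

lemma face_proj_collapse_fixed:
  assumes phi: "boxplus_hom (pow1 k) (pow2 n) \<phi>" and psi: "boxplus_hom (pow1 n) (pow2 m) \<psi>"
    and a: "a \<in> points (pow1 k)" and x: "x \<in> points (pow1 k)"
  defines "y \<equiv> map (\<lambda>i. min i 1) (\<phi> x)"
  defines "S \<equiv> comp_mor (pow1 n) \<psi> (face_proj n {\<phi> a}) ` points (pow1 n)"
  shows "face_proj m S (map (\<lambda>i. max 1 i - 1) (\<psi> y)) = map (\<lambda>i. max 1 i - 1) (\<psi> y)"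
proof -
  have px: "\<phi> x \<in> points (pow2 n)" by (rule boxplus_hom_points[OF phi x])
  then have y: "y \<in> points (pow1 n)" unfolding y_def by (rule unit_retraction_points[OF unit_retraction_gam_bar])
  have py: "\<psi> y \<in> points (pow2 m)" by (rule boxplus_hom_points[OF psi y])
  define z where "z = face_proj n {\<phi> a} y"
  have z: "z \<in> points (pow1 n)" unfolding z_def by (rule face_proj_points[OF y])
  have zS: "\<psi> z \<in> S" unfolding S_def z_def using y by (auto simp: compose_apply image_iff)
  have "z ! j \<le> y ! j" if j: "j < n" for j
    using boxplus_hom_cube_diameter[OF phi a x, of j] px j face_proj_nth[OF y j, of "{\<phi> a}"]
    by (auto simp: z_def y_def mem_points_replicate)
  then have zy: "list_all2 (\<le>) z y" using y z by (auto simp: list_all2_conv_all_nth mem_points_replicate)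
  have low: "\<psi> z ! i \<le> \<psi> y ! i" if "i < m" for i
    using monotone_mapsD(2)[OF boxplus_hom_monotone[OF psi] z y zy] that py
    by (auto simp: list_all2_conv_all_nth mem_points_replicate)
  have up: "\<psi> y ! i \<le> \<psi> z ! i + 1" if "i < m" for i
    using boxplus_hom_cube_diameter[OF psi y z] that by simp
  have q: "map (\<lambda>i. max 1 i - 1) (\<psi> y) \<in> points (pow1 m)"
    by (rule unit_retraction_points[OF unit_retraction_gam py])
  show ?thesis
  proof (rule nth_equalityI)
    show "length (face_proj m S (map (\<lambda>i. max 1 i - 1) (\<psi> y))) = length (map (\<lambda>i. max 1 i - 1) (\<psi> y))"
      using face_proj_points[OF q] q by (simp only: mem_points_replicate)
    fix i assume "i < length (face_proj m S (map (\<lambda>i. max 1 i - 1) (\<psi> y)))"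
    then have i: "i < m" using face_proj_points[OF q] by (simp only: mem_points_replicate)
    have *: "\<psi> y ! i \<le> 1" if "\<forall>s\<in>S. s ! i = 0" using up[OF i] zS that by auto
    have **: "\<psi> y ! i = 2" if "\<forall>s\<in>S. s ! i = 2" using low[OF i] zS that py i by (auto simp: mem_points_replicate intro: antisym)
    show "face_proj m S (map (\<lambda>i. max 1 i - 1) (\<psi> y)) ! i = map (\<lambda>i. max 1 i - 1) (\<psi> y) ! i"
      using * ** i py by (simp only: face_proj_nth[OF q i]) (auto simp: mem_points_replicate)
  qed
qed

section \<open>Subpresheaves and stars\<close>

lemma cubical_act_cells: "cubical_set C \<Longrightarrow> box_hom m n f \<Longrightarrow> x \<in> cells C n \<Longrightarrow> act C m n f x \<in> cells C m"
  by (simp add: cubical_set_def)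

lemma cubical_act_ident: "cubical_set C \<Longrightarrow> x \<in> cells C n \<Longrightarrow> act C n n (ident (pow1 n)) x = x"
  by (simp add: cubical_set_def)

lemma cubical_act_comp:
  "cubical_set C \<Longrightarrow> box_hom l m f \<Longrightarrow> box_hom m n g \<Longrightarrow> x \<in> cells C n \<Longrightarrow>
    act C l m f (act C m n g x) = act C l n (comp_mor (pow1 l) g f) x"
  by (simp add: cubical_set_def)

lemma subpresheaf_cells: "subpresheaf B C \<Longrightarrow> x \<in> B n \<Longrightarrow> x \<in> cells C n"
  by (auto simp: subpresheaf_def)

lemma subpresheaf_act: "subpresheaf B C \<Longrightarrow> x \<in> B n \<Longrightarrow> box_hom m n f \<Longrightarrow> act C m n f x \<in> B m"
  by (auto simp: subpresheaf_def)

lemma sub_cset_simps [simp]: "cells (sub_cset C B) = B" "act (sub_cset C B) = act C"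
  by (simp_all add: sub_cset_def)

lemma cubical_set_sub_cset: "cubical_set C \<Longrightarrow> subpresheaf B C \<Longrightarrow> cubical_set (sub_cset C B)"
  unfolding cubical_set_def sub_cset_simps subpresheaf_def by blast

lemma generated_eq:
  assumes "cubical_set C" "\<sigma> \<in> cells C n"
  shows "generated C n \<sigma> k = {act C k n f \<sigma> | f. box_hom k n f}"
proof
  let ?G = "\<lambda>k. {act C k n f \<sigma> | f. box_hom k n f}"
  have "subpresheaf ?G C"
    unfolding subpresheaf_def
  proof (intro conjI allI subsetI ballI impI)
    fix k x assume "x \<in> ?G k" then show "x \<in> cells C k" using assms by (auto intro: cubical_act_cells)
  next
    fix l k g x assume "x \<in> ?G k" "box_hom l k g"
    then obtain f where "box_hom k n f" "x = act C k n f \<sigma>" by auto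
    then have "act C l k g x = act C l n (comp_mor (pow1 l) f g) \<sigma>" "box_hom l n (comp_mor (pow1 l) f g)"
      using assms \<open>box_hom l k g\<close> by (simp_all add: cubical_act_comp box_hom.comp del: One_nat_def)
    then show "act C l k g x \<in> ?G l" by blast
  qed
  moreover have "\<sigma> \<in> ?G n"
    using cubical_act_ident[OF assms] box_hom_ident[of n] by (metis (mono_tags, lifting) mem_Collect_eq)
  ultimately show "generated C n \<sigma> k \<subseteq> ?G k"
    unfolding generated_def by (auto simp: Inf_apply)
  show "?G k \<subseteq> generated C n \<sigma> k"
    by (auto simp: generated_def Inf_apply intro: subpresheaf_act)
qed

lemma vertex_exists: "\<exists>p. box_hom 0 k p"
proof (induction k)
  case 0 then show ?case using box_hom_ident by blast
next
  case (Suc k)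
  then obtain p where p: "box_hom 0 k p" by blast
  have "box_hom 0 1 (\<lambda>x\<in>points []. [0])"
    by (intro box_hom.box1 monotone_mapsI) (auto simp: extensional_def)
  from box_hom.tensor[OF this p] show ?case by auto
qed

lemma box_hom_0_0: "box_hom 0 0 f \<Longrightarrow> f = ident (pow1 0)"
  using box_hom_points[of 0 0 f "[]"] box_hom_extensional[of 0 0 f] by (auto simp: ident_def extensional_def fun_eq_iff)

text \<open>An atomic subpresheaf meeting the one generated by \<open>v\<close> contains a
  degeneracy of \<open>v\<close>. Restricting this to any vertex gives back \<open>v\<close>, since
  [0] has only the identity endomorphism. Hence \<open>v\<close> is a vertex of the generating cell
  \<open>\<sigma>\<close>.\<close>

lemma Star_vertexE:
  assumes X: "cubical_set X" and v: "v \<in> cells X 0" and \<tau>: "\<tau> \<in> Star X (generated X 0 v) j"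
  obtains k \<sigma> f p where "\<sigma> \<in> cells X k" "box_hom j k f" "\<tau> = act X j k f \<sigma>" "box_hom 0 k p" "v = act X 0 k p \<sigma>"
proof -
  obtain A n where A: "subpresheaf A X" "atomic (sub_cset X A)" "A n \<inter> generated X 0 v n \<noteq> {}" "\<tau> \<in> A j"
    using \<tau> unfolding Star_def by (auto simp: Sup_apply)
  obtain k \<sigma> where \<sigma>: "\<sigma> \<in> A k" "A = generated (sub_cset X A) k \<sigma>"
    using A(2) unfolding atomic_def by auto
  have A_eq: "A i = {act X i k f \<sigma> | f. box_hom i k f}" for i
    using generated_eq[OF cubical_set_sub_cset[OF X A(1)], of \<sigma> k i] \<sigma> by simp
  have \<sigma>c: "\<sigma> \<in> cells X k" using A(1) \<sigma>(1) by (rule subpresheaf_cells)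
  obtain x g where x: "x \<in> A n" "box_hom n 0 g" "x = act X n 0 g v"
    using A(3) generated_eq[OF X v] by auto
  obtain q where q: "box_hom 0 n q" using vertex_exists by blast
  have "act X 0 n q x = act X 0 0 (comp_mor (pow1 0) g q) v"
    using x q X v by (simp add: cubical_act_comp)
  also have "\<dots> = v" using box_hom_0_0[OF box_hom.comp[OF q x(2)]] cubical_act_ident[OF X v] by simp
  finally have "v \<in> A 0" using subpresheaf_act[OF A(1) x(1) q] by simp
  then show ?thesis using that \<sigma>c A(4) unfolding A_eq by blast
qed

section \<open>Subdivision of cubical sets\<close>

lemma sd_class_self: "t \<in> sd_class C k t"
  by (simp add: sd_class_def)

lemma sd_class_eq:
  assumes "(s, t) \<in> sd_step C k"
  shows "sd_class C k s = sd_class C k t"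
proof -
  let ?R = "(sd_step C k \<union> (sd_step C k)\<inverse>)\<^sup>*"
  have "(s, t) \<in> ?R" "(t, s) \<in> ?R" using assms by auto
  then show ?thesis unfolding sd_class_def by (auto intro: rtrancl_trans)
qed

text \<open>Induction along a zigzag of generating steps. Functions and predicates on classes are
  thus compared across one step only, and the equivalence relation itself never has to be
  described.\<close>

lemma sd_class_invariant:
  assumes "\<And>s t. (s, t) \<in> sd_step C k \<Longrightarrow> F s = F t" "u \<in> sd_class C k t"
  shows "F u = F t"
proof -
  have "(t, u) \<in> (sd_step C k \<union> (sd_step C k)\<inverse>)\<^sup>*" using assms(2) by (simp add: sd_class_def)
  then show ?thesis by (induction rule: rtrancl_induct) (use assms(1) in force)+
qed

lemma sd_class_eqD:
  assumes "\<And>s t. (s, t) \<in> sd_step C k \<Longrightarrow> F s = F t" "sd_class C k s = sd_class C k t"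
  shows "F s = F t"
  using sd_class_invariant[of C k F, OF assms(1)] sd_class_self[of s C k] assms(2) by metis

lemma the_elem_sd_class:
  assumes "\<And>s t. (s, t) \<in> sd_step C k \<Longrightarrow> F s = F t"
  shows "the_elem (F ` sd_class C k t) = F t"
proof -
  have "F ` sd_class C k t = {F t}"
    using sd_class_invariant[of C k F, OF assms] sd_class_self[of t C k] by blast
  then show ?thesis by simp
qed

lemma sd_stepI:
  "box_hom m n f \<Longrightarrow> boxplus_hom (pow1 k) (pow2 m) \<phi> \<Longrightarrow> c \<in> cells C n \<Longrightarrow>
    ((m, \<phi>, act C m n f c), (n, comp_mor (pow1 k) (sd_mor m n f) \<phi>, c)) \<in> sd_step C k"
  by (auto simp: sd_step_def box_psh_def)

lemma sd_stepE:
  assumes "(s, t) \<in> sd_step C k"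
  obtains m n f \<phi> c where "s = (m, \<phi>, act C m n f c)" "t = (n, comp_mor (pow1 k) (sd_mor m n f) \<phi>, c)"
    "box_hom m n f" "boxplus_hom (pow1 k) (pow2 m) \<phi>" "c \<in> cells C n"
  using assms by (auto simp: sd_step_def box_psh_def)

lemma cells_sdI:
  "boxplus_hom (pow1 k) (pow2 n) \<phi> \<Longrightarrow> c \<in> cells C n \<Longrightarrow> sd_class C k (n, \<phi>, c) \<in> cells (sd C) k"
  by (auto simp: sd_def sd_pre_def box_psh_def)

lemma cells_sdE:
  assumes "X \<in> cells (sd C) k"
  obtains n \<phi> c where "X = sd_class C k (n, \<phi>, c)" "boxplus_hom (pow1 k) (pow2 n) \<phi>" "c \<in> cells C n"
  using assms by (auto simp: sd_def sd_pre_def box_psh_def)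

lemma boxplus_hom_precomp: "box_hom j k f \<Longrightarrow> boxplus_hom (pow1 k) L \<phi> \<Longrightarrow> boxplus_hom (pow1 j) L (comp_mor (pow1 j) \<phi> f)"
  by (rule boxplus_hom.comp[OF box_hom_boxplus_hom])

lemma act_sd_class:
  assumes "box_hom j k f"
  shows "act (sd C) j k f (sd_class C k (n, \<phi>, c)) = sd_class C j (n, comp_mor (pow1 j) \<phi> f, c)"
proof -
  let ?F = "\<lambda>(n, \<phi>, c). sd_class C j (n, act (box_psh (pow2 n)) j k f \<phi>, c)"
  have "?F s = ?F t" if "(s, t) \<in> sd_step C k" for s t
    using that
  proof (rule sd_stepE)
    fix m n g \<phi> c
    assume *: "s = (m, \<phi>, act C m n g c)" "t = (n, comp_mor (pow1 k) (sd_mor m n g) \<phi>, c)"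
      "box_hom m n g" "boxplus_hom (pow1 k) (pow2 m) \<phi>" "c \<in> cells C n"
    have "comp_mor (pow1 j) (comp_mor (pow1 k) (sd_mor m n g) \<phi>) f
        = comp_mor (pow1 j) (sd_mor m n g) (comp_mor (pow1 j) \<phi> f)"
      using box_hom_points[OF assms] by (auto simp: compose_def)
    then show "?F s = ?F t"
      using sd_class_eq[OF sd_stepI[OF *(3) boxplus_hom_precomp[OF assms *(4)] *(5)]]
      by (simp add: * box_psh_def)
  qed
  then have "the_elem (?F ` sd_class C k (n, \<phi>, c)) = ?F (n, \<phi>, c)" by (rule the_elem_sd_class)
  then show ?thesis by (simp add: sd_def box_psh_def)
qed

lemma cubical_set_sd: "cubical_set (sd C)"
  unfolding cubical_set_def
proof (intro conjI allI ballI impI)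
  fix m n f X assume "X \<in> cells (sd C) n" "box_hom m n f"
  then show "act (sd C) m n f X \<in> cells (sd C) m"
    by (auto elim!: cells_sdE simp: act_sd_class simp del: One_nat_def intro!: cells_sdI boxplus_hom_precomp)
next
  fix n X assume "X \<in> cells (sd C) n"
  then obtain i \<phi> c where X: "X = sd_class C n (i, \<phi>, c)" "boxplus_hom (pow1 n) (pow2 i) \<phi>" "c \<in> cells C i"
    by (rule cells_sdE)
  have "comp_mor (pow1 n) \<phi> (ident (pow1 n)) = \<phi>"
    using boxplus_hom_extensional[OF X(2)] by (auto simp: compose_def ident_def extensional_def)
  then show "act (sd C) n n (ident (pow1 n)) X = X" by (simp only: X(1) act_sd_class[OF box_hom_ident])
next
  fix l m n f g X assume "X \<in> cells (sd C) n" and f: "box_hom l m f" and g: "box_hom m n g"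
  then obtain i \<phi> c where X: "X = sd_class C n (i, \<phi>, c)" "boxplus_hom (pow1 n) (pow2 i) \<phi>" "c \<in> cells C i"
    by (auto elim: cells_sdE)
  have "comp_mor (pow1 l) \<phi> (comp_mor (pow1 l) g f) = comp_mor (pow1 l) (comp_mor (pow1 m) \<phi> g) f"
    using box_hom_points[OF f] by (auto simp: compose_def)
  then show "act (sd C) l n (comp_mor (pow1 l) g f) X = act (sd C) l m f (act (sd C) m n g X)"
    by (simp only: X(1) act_sd_class[OF f] act_sd_class[OF g] act_sd_class[OF box_hom.comp[OF f g]])
qed

section \<open>Subdivision of natural transformations, and the collapses on classes\<close>

definition natural :: "'a cset \<Rightarrow> 'b cset \<Rightarrow> (nat \<Rightarrow> 'a \<Rightarrow> 'b) \<Rightarrow> bool" where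
  "natural A D h \<longleftrightarrow> (\<forall>n. \<forall>c\<in>cells A n. h n c \<in> cells D n) \<and>
     (\<forall>m n f. \<forall>c\<in>cells A n. box_hom m n f \<longrightarrow> h m (act A m n f c) = act D m n f (h n c))"

lemma natural_inclusion: "subpresheaf B C \<Longrightarrow> natural (sub_cset C B) C (\<lambda>n x. x)"
  by (auto simp: natural_def subpresheaf_cells)

lemma sd_map_class:
  assumes "natural A D h"
  shows "sd_map D h k (sd_class A k (n, \<phi>, c)) = sd_class D k (n, \<phi>, h n c)"
proof -
  let ?F = "\<lambda>(n, \<phi>, c). sd_class D k (n, \<phi>, h n c)"
  have "?F s = ?F t" if "(s, t) \<in> sd_step A k" for s t
    using that
  proof (rule sd_stepE)
    fix m n g \<phi> c
    assume *: "s = (m, \<phi>, act A m n g c)" "t = (n, comp_mor (pow1 k) (sd_mor m n g) \<phi>, c)"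
      "box_hom m n g" "boxplus_hom (pow1 k) (pow2 m) \<phi>" "c \<in> cells A n"
    then have "h m (act A m n g c) = act D m n g (h n c)" "h n c \<in> cells D n"
      using assms by (auto simp: natural_def)
    then show "?F s = ?F t" using sd_class_eq[OF sd_stepI[OF *(3,4)]] by (simp add: *)
  qed
  then show ?thesis unfolding sd_map_def by (subst the_elem_sd_class[where F = ?F]) auto
qed

lemma natural_sd_map:
  assumes "natural A D h"
  shows "natural (sd A) (sd D) (sd_map D h)"
  using assms unfolding natural_def[of "sd A"]
  by (auto elim!: cells_sdE simp: sd_map_class act_sd_class natural_def intro!: cells_sdI)

text \<open>Applied to the map from the subdivision of \<open>B\<close> to that of \<open>C\<close>,
  this gives a subpresheaf of \<open>sd C\<close> against which the outer subdivision can be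
  tested.\<close>

lemma subpresheaf_image:
  assumes "cubical_set A" "natural A D h"
  shows "subpresheaf (\<lambda>n. h n ` cells A n) D"
  unfolding subpresheaf_def
proof (intro conjI allI subsetI ballI impI)
  fix m n f x assume "x \<in> h n ` cells A n" "box_hom m n f"
  then obtain c where c: "c \<in> cells A n" "x = h n c" by auto
  then have "act D m n f x = h m (act A m n f c)" using assms(2) \<open>box_hom m n f\<close> by (simp add: natural_def)
  then show "act D m n f x \<in> h m ` cells A m" using cubical_act_cells[OF assms(1) \<open>box_hom m n f\<close> c(1)] by auto
qed (use assms(2) in \<open>auto simp: natural_def\<close>)

text \<open>A presheaf on cubes acts through cube morphisms only, so fullness is needed before
  \<open>collapse\<close> can be computed on a representative.\<close>

lemma collapse_hom:
  assumes "unit_retraction h" "boxplus_hom (pow1 k) (pow2 n) \<phi>"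
  shows "box_hom k n (comp_mor (pow1 k) (\<lambda>x\<in>points (pow2 n). map h x) \<phi>)"
proof -
  have h: "h 0 = 0" "h 1 \<le> 1" "h 2 = 1" using assms(1) by (auto simp: unit_retraction_def)
  have mono: "h i \<le> h j" if "i \<le> j" "j \<le> 2" for i j
  proof -
    have "i = 0 \<or> i = 1 \<or> i = 2" "j = 0 \<or> j = 1 \<or> j = 2" using that by linarith+
    then show ?thesis using h that by auto
  qed
  have "to_unit (replicate n h) (pow2 n)"
    using unit_retraction_le[OF assms(1)] mono by (simp add: to_unit_def list_all2_conv_all_nth)
  moreover have "coordwise (replicate n h) (pow2 n) = (\<lambda>x\<in>points (pow2 n). map h x)"
    by (auto simp: coordwise_def mem_points_replicate intro!: restrict_ext nth_equalityI)
  ultimately show ?thesis using boxplus_hom_unit_target[OF assms(2)] by fastforce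
qed

lemma collapse_class:
  assumes C: "cubical_set C" and h: "unit_retraction h"
  shows "collapse h C k (sd_class C k (n, \<phi>, c)) =
    act C k n (comp_mor (pow1 k) (\<lambda>x\<in>points (pow2 n). map h x) \<phi>) c"
proof -
  let ?F = "\<lambda>(n, \<phi>, c). act C k n (comp_mor (pow1 k) (\<lambda>x\<in>points (pow2 n). map h x) \<phi>) c"
  have "?F s = ?F t" if "(s, t) \<in> sd_step C k" for s t
    using that
  proof (rule sd_stepE)
    fix m n g \<phi> c
    assume *: "s = (m, \<phi>, act C m n g c)" "t = (n, comp_mor (pow1 k) (sd_mor m n g) \<phi>, c)"
      "box_hom m n g" "boxplus_hom (pow1 k) (pow2 m) \<phi>" "c \<in> cells C n"
    have "comp_mor (pow1 k) g (comp_mor (pow1 k) (\<lambda>x\<in>points (pow2 m). map h x) \<phi>)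
        = comp_mor (pow1 k) (\<lambda>x\<in>points (pow2 n). map h x) (comp_mor (pow1 k) (sd_mor m n g) \<phi>)"
      using boxplus_hom_points[OF *(4)] boxplus_hom_points[OF boxplus_hom_sd_mor[OF *(3)]]
        sd_graph_natural[OF sd_graph_sd_mor[OF *(3)] h]
      by (auto simp: compose_def intro!: restrict_ext)
    then show "?F s = ?F t" 
      using cubical_act_comp[OF C collapse_hom[OF h *(4)] *(3,5)] by (simp add: *(1,2))
  qed
  then show ?thesis unfolding collapse_def by (subst the_elem_sd_class[where F = ?F]) auto
qed

text \<open>A test on a representative for its class to lie in the subdivision of \<open>B\<close>.
  Whether \<open>c\<close> itself belongs to \<open>B\<close> depends on the representative; its
  restriction to the face supporting the image of \<open>\<phi>\<close> does not.\<close>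

definition supported :: "'a cset \<Rightarrow> (nat \<Rightarrow> 'a set) \<Rightarrow> nat \<Rightarrow> nat \<times> mor \<times> 'a \<Rightarrow> bool" where
  "supported C B k = (\<lambda>(n, \<phi>, c). act C n n (face_proj n (\<phi> ` points (pow1 k))) c \<in> B n)"

lemma supported_step:
  assumes C: "cubical_set C" and B: "subpresheaf B C" and "(s, t) \<in> sd_step C k"
  shows "supported C B k s = supported C B k t"
  using assms(3)
proof (rule sd_stepE)
  fix m n f \<phi> c
  assume *: "s = (m, \<phi>, act C m n f c)" "t = (n, comp_mor (pow1 k) (sd_mor m n f) \<phi>, c)"
    "box_hom m n f" "boxplus_hom (pow1 k) (pow2 m) \<phi>" "c \<in> cells C n"
  define S where "S = \<phi> ` points (pow1 k)"
  define T where "T = comp_mor (pow1 k) (sd_mor m n f) \<phi> ` points (pow1 k)"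
  \<comment> \<open>\<open>e\<close> is \<open>f\<close> restricted to the face supporting
    \<open>S\<close>. The test at \<open>s\<close> asks whether \<open>c\<close> restricted along
    \<open>e\<close> lies in \<open>B\<close>, the test at \<open>t\<close> whether \<open>c\<close>
    restricted along the projection for \<open>T\<close> does. Each of these two maps factors
    through the other.\<close>
  define e where "e = comp_mor (pow1 m) f (face_proj m S)"
  have e: "box_hom m n e" unfolding e_def by (rule box_hom.comp[OF box_hom_face_proj *(3)])
  have T: "T = sd_mor m n f ` S" unfolding S_def T_def by (auto simp: compose_apply image_iff)
  have S: "S \<subseteq> points (pow2 m)" using boxplus_hom_points[OF *(4)] by (auto simp: S_def)
  have "replicate k 0 \<in> points (pow1 k)" by (simp add: mem_points_replicate)
  then have S0: "S \<noteq> {}" by (auto simp: S_def)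
  note g = sd_graph_sd_mor[OF *(3)]
  have s: "act C m m (face_proj m S) (act C m n f c) = act C m n e c"
    unfolding e_def by (rule cubical_act_comp[OF C box_hom_face_proj *(3,5)])
  show ?thesis
  proof
    assume "supported C B k t"
    then have "act C m n e (act C n n (face_proj n T) c) \<in> B m"
      using subpresheaf_act[OF B _ e] by (simp add: supported_def * T_def)
    moreover have "comp_mor (pow1 m) (face_proj n T) e = e"
      using sd_graph_face_proj_fixed[OF g S S0] by (auto simp: compose_def e_def T intro!: restrict_ext)
    ultimately show "supported C B k s"
      using cubical_act_comp[OF C e box_hom_face_proj *(5)] s by (simp add: supported_def *(1) S_def)
  next
    assume "supported C B k s"
    then have a: "act C m n e c \<in> B m" using s by (simp add: supported_def *(1) S_def)
    obtain u where u: "box_hom n m u" "\<forall>x\<in>points (pow1 n). f (face_proj m S (u x)) = face_proj n T x"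
      using sd_graph_face_proj_section[OF g S S0] unfolding T by blast
    have "comp_mor (pow1 n) e u = face_proj n T"
    proof (rule extensionalityI[of _ "points (pow1 n)"])
      show "face_proj n T \<in> extensional (points (pow1 n))" by (rule box_hom_extensional[OF box_hom_face_proj])
    qed (use u box_hom_points[OF u(1)] in \<open>auto simp: e_def compose_apply\<close>)
    then show "supported C B k t"
      using subpresheaf_act[OF B a u(1)] cubical_act_comp[OF C u(1) e *(5)] by (simp add: supported_def *(2) T_def)
  qed
qed

text \<open>The representative with \<open>c'\<close> in \<open>B\<close> passes the test because
  \<open>B\<close> is closed under restriction, and invariance carries the result to the other
  representative.\<close>

lemma supported_of_sd_sub:
  assumes "cubical_set C" "subpresheaf B C" "sd_class C k (n, \<phi>, c) = sd_class C k (n', \<phi>', c')" "c' \<in> B n'"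
  shows "act C n n (face_proj n (\<phi> ` points (pow1 k))) c \<in> B n"
proof -
  have "supported C B k (n', \<phi>', c')"
    using subpresheaf_act[OF assms(2,4) box_hom_face_proj] by (simp add: supported_def)
  then have "supported C B k (n, \<phi>, c)"
    using sd_class_eqD[of C k "supported C B k", OF supported_step[OF assms(1,2)] assms(3)] by simp
  then show ?thesis by (simp add: supported_def)
qed

theorem lemma6p13:
  fixes C :: "'a cset" and v :: "'a sd_cell sd_cell"
  assumes "cubical_set C"
    and "v \<in> cells (sd (sd C)) 0"
  shows "image_psh (gam_gam_bar C) (Star (sd (sd C)) (generated (sd (sd C)) 0 v))
      \<le> supp_sd2 (generated (sd (sd C)) 0 v) C"
proof (rule le_funI, rule subsetI)
  fix j b assume "b \<in> image_psh (gam_gam_bar C) (Star (sd (sd C)) (generated (sd (sd C)) 0 v)) j"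
  then obtain \<tau> where \<tau>: "\<tau> \<in> Star (sd (sd C)) (generated (sd (sd C)) 0 v) j" and b: "b = gam_gam_bar C j \<tau>"
    by (auto simp: image_psh_def)
  obtain k \<sigma> f p where f: "\<sigma> \<in> cells (sd (sd C)) k" "box_hom j k f" "\<tau> = act (sd (sd C)) j k f \<sigma>"
    and p: "box_hom 0 k p" "v = act (sd (sd C)) 0 k p \<sigma>"
    using Star_vertexE[OF cubical_set_sd assms(2) \<tau>] by metis
  obtain n \<phi> w where \<sigma>: "\<sigma> = sd_class (sd C) k (n, \<phi>, w)" "boxplus_hom (pow1 k) (pow2 n) \<phi>" "w \<in> cells (sd C) n"
    using f(1) by (rule cells_sdE)
  obtain m \<psi> c where w: "w = sd_class C n (m, \<psi>, c)" "boxplus_hom (pow1 n) (pow2 m) \<psi>" "c \<in> cells C m"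
    using \<sigma>(3) by (rule cells_sdE)
  \<comment> \<open>Barred \<gamma> sends \<open>\<tau>\<close> to \<open>w\<close> restricted along
    \<open>\<alpha>\<close>, and \<gamma> sends that to \<open>c\<close> restricted along
    \<open>\<beta>\<close>.\<close>
  define \<alpha> where "\<alpha> = comp_mor (pow1 j) (\<lambda>x\<in>points (pow2 n). map (\<lambda>i. min i 1) x) (comp_mor (pow1 j) \<phi> f)"
  define \<beta> where "\<beta> = comp_mor (pow1 j) (\<lambda>x\<in>points (pow2 m). map (\<lambda>i. max 1 i - 1) x) (comp_mor (pow1 j) \<psi> \<alpha>)"
  have \<alpha>: "box_hom j n \<alpha>"
    unfolding \<alpha>_def by (rule collapse_hom[OF unit_retraction_gam_bar boxplus_hom_precomp[OF f(2) \<sigma>(2)]])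
  have \<beta>: "box_hom j m \<beta>"
    unfolding \<beta>_def by (rule collapse_hom[OF unit_retraction_gam boxplus_hom_precomp[OF \<alpha> w(2)]])
  have b_eq: "b = act C j m \<beta> c"
    unfolding b gam_gam_bar_def gam_def gam_bar_def o_def f(3) \<sigma>(1) act_sd_class[OF f(2)]
      collapse_class[OF cubical_set_sd unit_retraction_gam_bar] \<alpha>_def[symmetric]
    unfolding w(1) act_sd_class[OF \<alpha>] collapse_class[OF assms(1) unit_retraction_gam] \<beta>_def ..
  define a where "a = p []"
  have a: "a \<in> points (pow1 k)" unfolding a_def using box_hom_points[OF p(1), of "[]"] by simp
  define S where "S = comp_mor (pow1 n) \<psi> (face_proj n {\<phi> a}) ` points (pow1 n)"
  have fixed: "comp_mor (pow1 j) (face_proj m S) \<beta> = \<beta>"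
  proof (rule extensionalityI[of _ "points (pow1 j)"])
    show "\<beta> \<in> extensional (points (pow1 j))" by (rule box_hom_extensional[OF \<beta>])
    fix x assume x: "x \<in> points (pow1 j)"
    have fx: "f x \<in> points (pow1 k)" by (rule box_hom_points[OF f(2) x])
    have \<alpha>x: "\<alpha> x = map (\<lambda>i. min i 1) (\<phi> (f x))"
      using x boxplus_hom_points[OF \<sigma>(2) fx] by (simp add: \<alpha>_def compose_apply)
    have "\<beta> x = map (\<lambda>i. max 1 i - 1) (\<psi> (\<alpha> x))"
      using x boxplus_hom_points[OF w(2) box_hom_points[OF \<alpha> x]] by (simp add: \<beta>_def compose_apply)
    then show "comp_mor (pow1 j) (face_proj m S) \<beta> x = \<beta> x"
      using face_proj_collapse_fixed[OF \<sigma>(2) w(2) a fx] x by (simp add: \<alpha>x S_def compose_apply)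
  qed simp
  have "b \<in> B j" if B: "subpresheaf B C" and vB: "generated (sd (sd C)) 0 v \<le> sd2_sub C B" for B
  proof -
    let ?i = "sd_map C (\<lambda>n x. x)"
    \<comment> \<open>The subdivision of \<open>B\<close>, seen inside \<open>sd C\<close>.\<close>
    let ?D = "\<lambda>n. ?i n ` cells (sd (sub_cset C B)) n"
    note nat = natural_sd_map[OF natural_inclusion[OF B]]
    have D: "subpresheaf ?D (sd C)" by (rule subpresheaf_image[OF cubical_set_sd nat])
    have "v \<in> generated (sd (sd C)) 0 v 0" by (auto simp: generated_def Inf_apply)
    then obtain V where V: "V \<in> cells (sd (sd (sub_cset C B))) 0" "v = sd_map (sd C) ?i 0 V"
      using vB by (auto simp: sd2_sub_def le_fun_def)
    obtain n' \<phi>' w' where V': "V = sd_class (sd (sub_cset C B)) 0 (n', \<phi>', w')" "w' \<in> cells (sd (sub_cset C B)) n'"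
      using V(1) by (rule cells_sdE)
    \<comment> \<open>Two representatives of \<open>v\<close>: one as a vertex of
      \<open>\<sigma>\<close>, the other coming from the double subdivision of \<open>B\<close>. The
      test is used first here, with \<open>?D\<close> as the subpresheaf of \<open>sd C\<close>, and
      then once more in \<open>C\<close>.\<close>
    have "sd_class (sd C) 0 (n, comp_mor (pow1 0) \<phi> p, w) = sd_class (sd C) 0 (n', \<phi>', ?i n' w')"
      using V(2) unfolding p(2) \<sigma>(1) act_sd_class[OF p(1)] V'(1) sd_map_class[OF nat] .
    from supported_of_sd_sub[OF cubical_set_sd D this] V'(2)
    have "act (sd C) n n (face_proj n (comp_mor (pow1 0) \<phi> p ` points (pow1 0))) w \<in> ?D n" by blast
    moreover have "comp_mor (pow1 0) \<phi> p ` points (pow1 0) = {\<phi> a}" by (simp add: compose_def a_def)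
    ultimately have "act (sd C) n n (face_proj n {\<phi> a}) w \<in> ?D n" by simp
    then have "sd_class C n (m, comp_mor (pow1 n) \<psi> (face_proj n {\<phi> a}), c) \<in> ?D n"
      by (simp only: w(1) act_sd_class[OF box_hom_face_proj])
    then obtain W where W: "W \<in> cells (sd (sub_cset C B)) n"
      "sd_class C n (m, comp_mor (pow1 n) \<psi> (face_proj n {\<phi> a}), c) = ?i n W" by auto
    obtain m' \<psi>' c' where W': "W = sd_class (sub_cset C B) n (m', \<psi>', c')" "c' \<in> cells (sub_cset C B) m'"
      using W(1) by (rule cells_sdE)
    have "act C m m (face_proj m S) c \<in> B m"
      unfolding S_def
      using W(2) W'(2) by (intro supported_of_sd_sub[OF assms(1) B])
        (auto simp: W'(1) sd_map_class[OF natural_inclusion[OF B]])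
    \<comment> \<open>As \<open>\<beta>\<close> takes values in the face supporting
      \<open>S\<close>, restricting further along \<open>\<beta>\<close> makes the projection
      disappear and yields \<open>b\<close>.\<close>
    then have "act C j m \<beta> (act C m m (face_proj m S) c) \<in> B j" by (rule subpresheaf_act[OF B _ \<beta>])
    then show ?thesis
      using cubical_act_comp[OF assms(1) \<beta> box_hom_face_proj w(3)] fixed b_eq by simp
  qed
  then show "b \<in> supp_sd2 (generated (sd (sd C)) 0 v) C j"
    by (auto simp: supp_sd2_def Inf_apply)
qed

end
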